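(* Let $P=(V,\preceq)$ be a Borel poset of finite width $k$ whose incomparability graph $G_P$ is locally countable and such that the connectedness equivalence relation $E_{G_P}$ is smooth. Then $V$ can be decomposed into $k$ chains of $P$, each of which is a Borel subset of $V$.
   Context: A Borel poset is a poset $(V,\preceq)$ where $V$ is a standard Borel space and the relation $\preceq$ is a Borel subset of $V\times V$. The width is the maximum size of an antichain. The incomparability graph $G_P$ has vertex set $V$, distinct incomparable elements being adjacent; it is locally countable if each vertex has countably many neighbours. $E_{G_P}$ is the equivalence relation on $V$ where $x E_{G_P} y$ iff there is a finite path from $x$ to $y$ in $G_P$. A Borel equivalence relation is smooth if it admits a Borel transversal, i.e. a Borel set meeting every equivalence class in exactly one point. *)

theory Defs
  imports "HOL-Analysis.Analysis"
begin

text \<open>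
  Measurable spaces are represented by \<^typ>\<open>'a measure\<close>; only \<^const>\<open>space\<close> and
  \<^const>\<open>sets\<close> are used, the measure itself is irrelevant.
\<close>

definition standard_borel :: "'a measure \<Rightarrow> bool" where
  "standard_borel M \<longleftrightarrow>
     (\<exists>X. completely_metrizable_space X \<and> second_countable X \<and>
          topspace X = space M \<and> sets M = sigma_sets (space M) {U. openin X U})"

text \<open>
  \<^term>\<open>(x, y) \<in> r\<close> means that x lies below y.  The Borel subsets of the product of a standard
  Borel space with itself are the members of the product sigma-algebra, by second countability.
\<close>

definition borel_poset :: "'a measure \<Rightarrow> 'a rel \<Rightarrow> bool" where
  "borel_poset M r \<longleftrightarrow>
     standard_borel M \<and> partial_order_on (space M) r \<and> r \<in> sets (M \<Otimes>\<^sub>M M)"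

definition antichain :: "'a set \<Rightarrow> 'a rel \<Rightarrow> 'a set \<Rightarrow> bool" where
  "antichain V r A \<longleftrightarrow> A \<subseteq> V \<and> pairwise (\<lambda>x y. (x, y) \<notin> r) A"

definition has_width :: "'a set \<Rightarrow> 'a rel \<Rightarrow> nat \<Rightarrow> bool" where
  "has_width V r k \<longleftrightarrow>
     (\<exists>A. antichain V r A \<and> finite A \<and> card A = k) \<and>
     (\<forall>A. antichain V r A \<longrightarrow> finite A \<and> card A \<le> k)"

definition incomp_graph :: "'a set \<Rightarrow> 'a rel \<Rightarrow> 'a rel" where
  "incomp_graph V r = {(x, y). x \<in> V \<and> y \<in> V \<and> x \<noteq> y \<and> (x, y) \<notin> r \<and> (y, x) \<notin> r}"

definition locally_countable :: "'a set \<Rightarrow> 'a rel \<Rightarrow> bool" where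
  "locally_countable V G \<longleftrightarrow> (\<forall>x\<in>V. countable (G `` {x}))"

text \<open>The reflexive transitive closure is reflexive on the whole type, hence the restriction to V.\<close>

definition connected_rel :: "'a set \<Rightarrow> 'a rel \<Rightarrow> 'a rel" where
  "connected_rel V G = {(x, y). x \<in> V \<and> y \<in> V \<and> (x, y) \<in> G\<^sup>*}"

definition borel_equiv :: "'a measure \<Rightarrow> 'a rel \<Rightarrow> bool" where
  "borel_equiv M E \<longleftrightarrow> equiv (space M) E \<and> E \<in> sets (M \<Otimes>\<^sub>M M)"

definition borel_transversal :: "'a measure \<Rightarrow> 'a rel \<Rightarrow> 'a set \<Rightarrow> bool" where
  "borel_transversal M E T \<longleftrightarrow> T \<in> sets M \<and> (\<forall>C \<in> space M // E. \<exists>!x. x \<in> T \<inter> C)"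

definition smooth_equiv :: "'a measure \<Rightarrow> 'a rel \<Rightarrow> bool" where
  "smooth_equiv M E \<longleftrightarrow> borel_equiv M E \<and> (\<exists>T. borel_transversal M E T)"

end

theory Submission
  imports Defs
begin

text \<open>
  Elements of different components of the incomparability graph are comparable, so it suffices to
  colour each component properly with \<open>k\<close> colours in a Borel way.  The components are countable.
  Because their equivalence relation \<open>E\<close> is smooth, the Lusin-Novikov theorem, applied to \<open>E\<close> and
  composed with the Borel map onto the transversal, enumerates each component by Borel functions
  \<open>g n\<close> that are constant on components.  Dilworth's theorem for finite posets provides colourings
  of finite parts, and the lexicographically least colouring of the indices is then a Borel function
  of the component.
\<close>

section \<open>Borel sets as projections of closed sets\<close>

text \<open>The obstacle is to choose one colouring per component in a Borel way. If every point
  enumerated its component from its own position, two incomparable points could consult different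
  colourings; evaluating the enumeration at the representative in the transversal makes the graph
  induced on the indices a function of the component. Since a component may be infinite, compactness
  is needed to pass from finite colourings to a full one. Taking the least admissible colour at each
  index replaces a choice by Borel conditions, because admissibility only asks about finite pieces.
  Lusin-Novikov itself rests on the separation of disjoint images of Borel sets, and such images
  become tractable as continuous images of closed sets.\<close>

lemma continuous_on_seq_comp:
  "continuous_on S (\<lambda>z::nat \<Rightarrow> 'a::topological_space. \<lambda>n. z (f n))"
  by (intro continuous_on_coordinatewise_then_product
      continuous_on_subset[OF continuous_on_product_coordinates subset_UNIV])

text \<open>In a Polish space these are the analytic sets. Real sequences serve as a fixed space of
  witnesses because one sequence can store an additional number, which handles unions, or countably
  many sequences, which handles intersections.\<close>

definition closed_projection :: "'a::metric_space set \<Rightarrow> bool" where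
  "closed_projection B \<longleftrightarrow> (\<exists>C :: ('a \<times> (nat \<Rightarrow> real)) set. closed C \<and> B = fst ` C)"

lemma closed_projection_closed:
  assumes "closed B" shows "closed_projection B"
  unfolding closed_projection_def
  by (rule exI[of _ "B \<times> UNIV"]) (use assms in \<open>auto intro: closed_Times\<close>)

lemma closed_projection_UN:
  assumes "\<And>i::nat. closed_projection (B i)"
  shows "closed_projection (\<Union>i. B i)"
proof -
  obtain C where C: "\<And>i. closed (C i :: ('a \<times> (nat \<Rightarrow> real)) set)" and BC: "\<And>i. B i = fst ` C i"
    using assms unfolding closed_projection_def by metis
  \<comment> \<open>Coordinate 0 stores the index \<open>i\<close>, the shifted rest a witness for
    \<open>B i\<close>. Stating the constraint for every \<open>n\<close>, as "coordinate 0 is at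
    distance at least 1 from \<open>n\<close>, or the rest fits \<open>C n\<close>", presents
    \<open>D\<close> as an intersection of closed sets.\<close>
  define D where "D = {p. snd p 0 \<in> \<nat>} \<inter>
    (\<Inter>n. {p. 1 \<le> \<bar>snd p 0 - real n\<bar>} \<union> (\<lambda>p. (fst p, \<lambda>m. snd p (Suc m))) -` C n)"
  have c0: "continuous_on UNIV (\<lambda>p::'a \<times> (nat \<Rightarrow> real). snd p 0)"
    by (rule continuous_on_compose2[OF continuous_on_product_coordinates])
      (auto intro: continuous_intros)
  then have "closed ((\<lambda>p::'a \<times> (nat \<Rightarrow> real). snd p 0) -` \<nat>)"
    by (intro closed_vimage closed_Nats)
  then have "closed {p::'a \<times> (nat \<Rightarrow> real). snd p 0 \<in> \<nat>}"
    by (simp add: vimage_def)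
  moreover have "closed {p::'a \<times> (nat \<Rightarrow> real). 1 \<le> \<bar>snd p 0 - real n\<bar>}" for n
    by (intro closed_Collect_le continuous_intros c0)
  moreover have "closed ((\<lambda>p. (fst p, \<lambda>m. snd p (Suc m))) -` C n)" for n
  proof (rule closed_vimage[OF C])
    have "continuous_on UNIV (\<lambda>p::'a \<times> (nat \<Rightarrow> real). (\<lambda>z m. z (Suc m)) (snd p))"
      by (rule continuous_on_compose2[OF continuous_on_seq_comp[of UNIV Suc]])
        (auto intro: continuous_intros)
    then show "continuous_on UNIV (\<lambda>p::'a \<times> (nat \<Rightarrow> real). (fst p, \<lambda>m. snd p (Suc m)))"
      by (intro continuous_on_Pair continuous_on_fst continuous_on_id) auto
  qed
  ultimately have "closed D"
    unfolding D_def by (intro closed_Int closed_INT ballI closed_Un) auto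
  moreover have "(\<Union>i. B i) = fst ` D"
  proof (intro set_eqI iffI)
    fix x assume "x \<in> (\<Union>i. B i)"
    then obtain i z where "(x, z) \<in> C i" using BC by auto
    moreover have "1 \<le> \<bar>real i - real j\<bar>" if "i \<noteq> j" for j
      using that by (cases i j rule: linorder_cases) auto
    ultimately have "(x, case_nat (real i) z) \<in> D" by (force simp: D_def)
    then show "x \<in> fst ` D" by force
  next
    fix x assume "x \<in> fst ` D"
    then obtain z where "(x, z) \<in> D" by auto
    then obtain n where "z 0 = real n" by (auto simp: D_def Nats_def)
    with \<open>(x, z) \<in> D\<close> have "(x, \<lambda>m. z (Suc m)) \<in> C n" by (auto simp: D_def dest: spec[of _ n])
    then show "x \<in> (\<Union>i. B i)" using BC by force
  qed
  ultimately show ?thesis unfolding closed_projection_def by blast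
qed

lemma closed_projection_INT:
  assumes "\<And>i::nat. closed_projection (B i)"
  shows "closed_projection (\<Inter>i. B i)"
proof -
  obtain C where C: "\<And>i. closed (C i :: ('a \<times> (nat \<Rightarrow> real)) set)" and BC: "\<And>i. B i = fst ` C i"
    using assms unfolding closed_projection_def by metis
  define D where "D = (\<Inter>i. (\<lambda>p. (fst p, \<lambda>m. snd p (prod_encode (i, m)))) -` C i)"
  have "closed ((\<lambda>p. (fst p, \<lambda>m. snd p (prod_encode (i, m)))) -` C i)" for i
  proof (rule closed_vimage[OF C])
    have "continuous_on UNIV (\<lambda>p::'a \<times> (nat \<Rightarrow> real). (\<lambda>z m. z (prod_encode (i, m))) (snd p))"
      by (rule continuous_on_compose2[OF continuous_on_seq_comp[of UNIV "\<lambda>m. prod_encode (i, m)"]])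
        (auto intro: continuous_intros)
    then show "continuous_on UNIV (\<lambda>p::'a \<times> (nat \<Rightarrow> real). (fst p, \<lambda>m. snd p (prod_encode (i, m))))"
      by (intro continuous_on_Pair continuous_on_fst continuous_on_id) auto
  qed
  then have "closed D"
    unfolding D_def by (intro closed_INT ballI)
  moreover have "(\<Inter>i. B i) = fst ` D"
  proof (intro set_eqI iffI)
    fix x assume "x \<in> (\<Inter>i. B i)"
    then have "\<forall>i. \<exists>z. (x, z) \<in> C i" using BC by force
    then obtain z where "\<And>i. (x, z i) \<in> C i" by metis
    then have "(x, \<lambda>k. case prod_decode k of (i, m) \<Rightarrow> z i m) \<in> D" by (auto simp: D_def)
    then show "x \<in> fst ` D" by force
  next
    fix x assume "x \<in> fst ` D"
    then obtain z where "(x, z) \<in> D" by auto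
    then have "(x, \<lambda>m. z (prod_encode (i, m))) \<in> C i" for i by (auto simp: D_def)
    then show "x \<in> (\<Inter>i. B i)" using BC by force
  qed
  ultimately show ?thesis unfolding closed_projection_def by blast
qed

lemma closed_projection_open:
  assumes "open B" shows "closed_projection B"
proof -
  \<comment> \<open>The closed sets of points at distance at least \<open>1 / (n + 1)\<close> from
    the complement exhaust \<open>B\<close>. For \<open>B = UNIV\<close> the complement is empty and
    \<open>infdist\<close> is 0 by convention, so that case is settled by closedness.\<close>
  have "B = (\<Union>n. {x. inverse (real (Suc n)) \<le> infdist x (- B)})" if "B \<noteq> UNIV"
  proof (intro set_eqI iffI)
    fix x assume "x \<in> B"
    then have "infdist x (- B) > 0"
      using assms that by (intro infdist_pos_not_in_closed) auto
    then show "x \<in> (\<Union>n. {x. inverse (real (Suc n)) \<le> infdist x (- B)})"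
      using reals_Archimedean[of "infdist x (- B)"] by (auto intro: less_imp_le)
  next
    fix x assume "x \<in> (\<Union>n. {x. inverse (real (Suc n)) \<le> infdist x (- B)})"
    then obtain n where n: "inverse (real (Suc n)) \<le> infdist x (- B)" by auto
    have "inverse (real (Suc n)) > 0" by simp
    with n have "infdist x (- B) > 0" by linarith
    then show "x \<in> B" by (metis ComplI infdist_zero less_irrefl)
  qed
  moreover have "closed {x. inverse (real (Suc n)) \<le> infdist x (- B)}" for n
    by (intro closed_Collect_le continuous_intros)
  ultimately show ?thesis
    by (metis (no_types, lifting) closed_UNIV closed_projection_UN closed_projection_closed)
qed

lemma borel_closed_projection:
  fixes B :: "'a::metric_space set"
  assumes "B \<in> sets borel"
  obtains C :: "('a \<times> (nat \<Rightarrow> real)) set" where "closed C" "B = fst ` C"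
proof -
  have "B \<in> sigma_sets UNIV {S. open S}"
    using assms by (simp add: borel_def)
  \<comment> \<open>Complements are carried along because projections of closed sets are not in
    general preserved by complementation; the complement of a union becomes a countable
    intersection.\<close>
  then have "closed_projection B \<and> closed_projection (- B)"
  proof induction
    case (Basic U)
    then show ?case by (auto intro: closed_projection_open closed_projection_closed)
  next
    case Empty
    then show ?case by (auto intro: closed_projection_closed)
  next
    case (Compl B)
    then show ?case by (simp add: Compl_eq_Diff_UNIV[symmetric])
  next
    case (Union B)
    then show ?case
      using closed_projection_UN[of B] closed_projection_INT[of "\<lambda>i. - B i"] by simp
  qed
  then show thesis using that unfolding closed_projection_def by blast
qed

section \<open>Lusin separation\<close>

instance prod :: (polish_space, polish_space) polish_space ..

definition borel_separated :: "'a::topological_space set \<Rightarrow> 'a set \<Rightarrow> bool" where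
  "borel_separated A B \<longleftrightarrow> (\<exists>D\<in>sets borel. A \<subseteq> D \<and> D \<inter> B = {})"

lemma borel_separated_empty: "borel_separated {} B" "borel_separated A {}"
  unfolding borel_separated_def by (auto intro: bexI[of _ UNIV])

text \<open>For fixed \<open>i\<close>, the intersection over \<open>j\<close> still contains
  \<open>A i\<close> and misses every \<open>B j\<close>. Contrapositively, if two countable unions
  cannot be separated, some pair of pieces cannot; this allows repeated subdivision.\<close>

lemma borel_separated_UN:
  assumes "\<And>(i::nat) (j::nat). borel_separated (A i) (B j)"
  shows "borel_separated (\<Union>i. A i) (\<Union>j. B j)"
proof -
  obtain D where D: "\<And>i j. D i j \<in> sets borel" "\<And>i j. A i \<subseteq> D i j" "\<And>i j. D i j \<inter> B j = {}"
    using assms unfolding borel_separated_def by metis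
  have "(\<Union>i. \<Inter>j. D i j) \<in> sets borel"
    by (intro sets.countable_UN' sets.countable_INT'' countableI_type) (use D(1) in auto)
  moreover have "(\<Union>i. A i) \<subseteq> (\<Union>i. \<Inter>j. D i j)" using D(2) by blast
  moreover have "(\<Union>i. \<Inter>j. D i j) \<inter> (\<Union>j. B j) = {}" using D(3) by blast
  ultimately show ?thesis unfolding borel_separated_def by blast
qed

lemma dense_sequence:
  obtains d :: "nat \<Rightarrow> 'a::{metric_space, second_countable_topology}"
  where "\<And>x e. e > 0 \<Longrightarrow> \<exists>i. dist x (d i) < e"
proof -
  obtain D :: "'a set" where D: "countable D" "\<And>X. open X \<Longrightarrow> X \<noteq> {} \<Longrightarrow> \<exists>d\<in>D. d \<in> X"
    using countable_dense_setE by blast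
  have "\<exists>i. dist x (from_nat_into D i) < e" if "e > 0" for x :: 'a and e
  proof -
    have "\<exists>c\<in>D. c \<in> ball x e" using D(2)[of "ball x e"] that by auto
    then obtain c where "c \<in> D" "dist x c < e" by auto
    then show ?thesis using from_nat_into_surj[OF D(1) \<open>c \<in> D\<close>] by auto
  qed
  then show thesis using that by blast
qed

text \<open>Inseparability passes to some pair of small closed pieces of \<open>K\<close> and
  \<open>L\<close>. By completeness these shrink to points \<open>a\<close> and \<open>b\<close>,
  and \<open>f a \<noteq> f b\<close> since the images are disjoint. By continuity, disjoint
  neighbourhoods of \<open>f a\<close> and \<open>f b\<close> separate a late pair, a
  contradiction.\<close>

lemma lusin_separation_closed:
  fixes f :: "'c::polish_space \<Rightarrow> 'x::t2_space"
  assumes K: "closed K" "closed L" and f: "continuous_on UNIV f" and disj: "f ` K \<inter> f ` L = {}"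
  shows "borel_separated (f ` K) (f ` L)"
proof (rule ccontr)
  assume nsep: "\<not> ?thesis"
  obtain d :: "nat \<Rightarrow> 'c" where d: "\<And>x e. e > 0 \<Longrightarrow> \<exists>i. dist x (d i) < e"
    using dense_sequence by blast
  define cov where "cov n i = cball (d i) (1 / 2 ^ n)" for n i :: nat
  have cov: "(\<Union>i. cov n i) = UNIV" for n
    using d[of "1 / 2 ^ n"] unfolding cov_def by (force simp: dist_commute intro: less_imp_le)
  let ?P = "\<lambda>n (ST :: 'c set \<times> 'c set). closed (fst ST) \<and> closed (snd ST) \<and>
     \<not> borel_separated (f ` (K \<inter> fst ST)) (f ` (L \<inter> snd ST))"
  let ?Q = "\<lambda>n (ST :: 'c set \<times> 'c set) ST'. fst ST' \<subseteq> fst ST \<and> snd ST' \<subseteq> snd ST \<and>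
     (\<exists>i. fst ST' \<subseteq> cov n i) \<and> (\<exists>i. snd ST' \<subseteq> cov n i)"
  have "\<exists>\<sigma>. \<forall>n. ?P n (\<sigma> n) \<and> ?Q n (\<sigma> n) (\<sigma> (Suc n))"
  proof (rule dependent_nat_choice)
    show "\<exists>x. ?P 0 x" by (rule exI[of _ "(UNIV, UNIV)"]) (use nsep in auto)
  next
    fix ST :: "'c set \<times> 'c set" and n
    assume P: "?P n ST"
    have "\<exists>i j. \<not> borel_separated (f ` (K \<inter> (fst ST \<inter> cov n i))) (f ` (L \<inter> (snd ST \<inter> cov n j)))"
    proof (rule ccontr)
      assume "\<not> ?thesis"
      then have "borel_separated (\<Union>i. f ` (K \<inter> (fst ST \<inter> cov n i))) (\<Union>j. f ` (L \<inter> (snd ST \<inter> cov n j)))"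
        by (intro borel_separated_UN) auto
      moreover have "(\<Union>i. f ` (K' \<inter> (S \<inter> cov n i))) = f ` (K' \<inter> S)" for K' S
        using cov[of n] by blast
      ultimately show False using P by simp
    qed
    then obtain i j where ij: "\<not> borel_separated (f ` (K \<inter> (fst ST \<inter> cov n i))) (f ` (L \<inter> (snd ST \<inter> cov n j)))"
      by blast
    show "\<exists>ST'. ?P (Suc n) ST' \<and> ?Q n ST ST'"
      by (rule exI[of _ "(fst ST \<inter> cov n i, snd ST \<inter> cov n j)"])
        (use P ij in \<open>auto simp: cov_def intro: closed_Int\<close>)
  qed
  then obtain \<sigma> where "\<forall>n. ?P n (\<sigma> n) \<and> ?Q n (\<sigma> n) (\<sigma> (Suc n))" ..
  then have \<sigma>: "?P n (\<sigma> n)" "?Q n (\<sigma> n) (\<sigma> (Suc n))" for n by blast+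
  have limit: "\<exists>a\<in>K'. \<forall>e>0. \<exists>n. S n \<subseteq> ball a e"
    if S: "\<And>n. closed (S n)" "\<And>n. S (Suc n) \<subseteq> S n" "\<And>n. \<exists>i. S (Suc n) \<subseteq> cov n i"
      "\<And>n. K' \<inter> S n \<noteq> {}" "closed K'" for S :: "nat \<Rightarrow> 'c set" and K'
  proof -
    have small: "\<exists>n. \<forall>x\<in>S n. \<forall>y\<in>S n. dist x y < e" if "e > 0" for e
    proof -
      obtain n where "(1 / 2) ^ n < e / 2" using real_arch_pow_inv[of "e/2" "1/2"] \<open>e > 0\<close> by auto
      then have n: "1 / 2 ^ n < e / 2" by (simp add: power_one_over)
      obtain i where i: "S (Suc n) \<subseteq> cov n i" using S(3) by blast
      have "dist x y < e" if "x \<in> S (Suc n)" "y \<in> S (Suc n)" for x y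
      proof -
        have "dist (d i) x \<le> 1 / 2 ^ n" "dist (d i) y \<le> 1 / 2 ^ n"
          using i that unfolding cov_def by auto
        then show ?thesis using n dist_triangle3[of x y "d i"] by linarith
      qed
      then show ?thesis by blast
    qed
    have "\<exists>a. \<forall>n. a \<in> K' \<inter> S n"
    proof (rule decreasing_closed_nest[of "\<lambda>n. K' \<inter> S n"])
      show "closed (K' \<inter> S n)" for n using S by auto
      show "K' \<inter> S n \<noteq> {}" for n using S by auto
      show "K' \<inter> S n \<subseteq> K' \<inter> S m" if "m \<le> n" for m n
        using lift_Suc_antimono_le[of S, OF S(2) that] by blast
      show "\<exists>n. \<forall>x\<in>K' \<inter> S n. \<forall>y\<in>K' \<inter> S n. dist x y < e" if "e > 0" for e
        using small[OF that] by blast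
    qed blast
    then obtain a where a: "\<And>n. a \<in> K' \<inter> S n" by blast
    have "\<exists>n. S n \<subseteq> ball a e" if "e > 0" for e
      using small[OF that] a by (metis IntD2 mem_ball subsetI)
    with a show ?thesis by blast
  qed
  have ne: "K \<inter> fst (\<sigma> n) \<noteq> {}" "L \<inter> snd (\<sigma> n) \<noteq> {}" for n
    using \<sigma>(1)[of n] borel_separated_empty by (metis image_empty)+
  obtain a where a: "a \<in> K" "\<And>e. e > 0 \<Longrightarrow> \<exists>n. fst (\<sigma> n) \<subseteq> ball a e"
    using limit[of "\<lambda>n. fst (\<sigma> n)" K] \<sigma> ne K by metis
  obtain b where b: "b \<in> L" "\<And>e. e > 0 \<Longrightarrow> \<exists>n. snd (\<sigma> n) \<subseteq> ball b e"
    using limit[of "\<lambda>n. snd (\<sigma> n)" L] \<sigma> ne K by metis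
  have "f a \<noteq> f b" using a b disj by blast
  then obtain U V where UV: "open U" "open V" "f a \<in> U" "f b \<in> V" "U \<inter> V = {}"
    by (meson hausdorff)
  have "open (f -` U)" "open (f -` V)" using UV f by (simp_all add: open_vimage)
  then obtain e1 e2 where e: "e1 > 0" "ball a e1 \<subseteq> f -` U" "e2 > 0" "ball b e2 \<subseteq> f -` V"
    using UV by (metis open_contains_ball vimageI)
  obtain n m where nm: "fst (\<sigma> n) \<subseteq> f -` U" "snd (\<sigma> m) \<subseteq> f -` V"
    using a(2)[OF e(1)] b(2)[OF e(3)] e by blast
  have "fst (\<sigma> (max n m)) \<subseteq> fst (\<sigma> n)" "snd (\<sigma> (max n m)) \<subseteq> snd (\<sigma> m)"
    using lift_Suc_antimono_le[of "\<lambda>n. fst (\<sigma> n)" n "max n m"]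
      lift_Suc_antimono_le[of "\<lambda>n. snd (\<sigma> n)" m "max n m"] \<sigma>(2) by auto
  then have "f ` (K \<inter> fst (\<sigma> (max n m))) \<subseteq> U" "f ` (L \<inter> snd (\<sigma> (max n m))) \<subseteq> V"
    using nm by auto
  then have "borel_separated (f ` (K \<inter> fst (\<sigma> (max n m)))) (f ` (L \<inter> snd (\<sigma> (max n m))))"
    unfolding borel_separated_def using UV by (intro bexI[of _ U]) auto
  with \<sigma>(1) show False by blast
qed

text \<open>The graph of \<open>\<phi>\<close> over a Borel set is Borel in the product, hence a
  projection of a closed set. The images of \<open>P\<close> and \<open>Q\<close> are therefore
  images of closed sets under one and the same continuous coordinate map.\<close>

lemma lusin_separation:
  fixes \<phi> :: "'e::polish_space \<Rightarrow> 'x::polish_space"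
  assumes P: "P \<in> sets borel" and Q: "Q \<in> sets borel" and \<phi>: "\<phi> \<in> borel_measurable borel"
    and disj: "\<phi> ` P \<inter> \<phi> ` Q = {}"
  shows "borel_separated (\<phi> ` P) (\<phi> ` Q)"
proof -
  have graph: "\<exists>C :: (('e \<times> 'x) \<times> (nat \<Rightarrow> real)) set. closed C \<and> \<phi> ` S = (\<lambda>c. snd (fst c)) ` C"
    if S: "S \<in> sets borel" for S
  proof -
    note \<phi>[measurable] S[measurable]
    have "{p \<in> space (borel \<Otimes>\<^sub>M borel). fst p \<in> S \<and> \<phi> (fst p) = snd p} \<in> sets (borel \<Otimes>\<^sub>M borel)"
      by measurable
    then have "{p. fst p \<in> S \<and> \<phi> (fst p) = snd p} \<in> sets borel"
      unfolding borel_prod by simp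
    then obtain C :: "(('e \<times> 'x) \<times> (nat \<Rightarrow> real)) set"
      where C: "closed C" "{p. fst p \<in> S \<and> \<phi> (fst p) = snd p} = fst ` C"
      using borel_closed_projection by blast
    have "\<phi> ` S = snd ` {p. fst p \<in> S \<and> \<phi> (fst p) = snd p}"
      by (auto simp: image_def)
    with C show ?thesis by (intro exI[of _ C]) (simp add: image_image)
  qed
  obtain C D :: "(('e \<times> 'x) \<times> (nat \<Rightarrow> real)) set" where
    "closed C" "\<phi> ` P = (\<lambda>c. snd (fst c)) ` C" "closed D" "\<phi> ` Q = (\<lambda>c. snd (fst c)) ` D"
    using graph[OF P] graph[OF Q] by blast
  then show ?thesis
    using lusin_separation_closed[OF _ _ continuous_on_snd[OF continuous_on_fst[OF continuous_on_id]], of C D] disj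
    by metis
qed

text \<open>The image of \<open>Q\<close> need not be Borel, so \<open>\<psi>\<close> cannot simply
  be transported along \<open>\<phi>\<close>. Instead \<open>\<psi>\<close> is discretised at scale
  \<open>1 / 2 ^ k\<close>. By \<open>det\<close> the level sets have disjoint images; separation
  encloses these in Borel sets from which the discrete value can be read off, and \<open>h\<close>
  is the limit.\<close>

lemma borel_factorization:
  fixes \<phi> :: "'e::polish_space \<Rightarrow> 'x::polish_space" and \<psi> :: "'e \<Rightarrow> 'y::polish_space"
  assumes Q: "Q \<in> sets borel" and \<phi>: "\<phi> \<in> borel_measurable borel" and \<psi>: "\<psi> \<in> borel_measurable borel"
    and det: "\<And>e e'. e \<in> Q \<Longrightarrow> e' \<in> Q \<Longrightarrow> \<phi> e = \<phi> e' \<Longrightarrow> \<psi> e = \<psi> e'"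
  obtains h where "h \<in> borel_measurable borel" "\<And>e. e \<in> Q \<Longrightarrow> h (\<phi> e) = \<psi> e"
proof -
  note Q[measurable] \<phi>[measurable] \<psi>[measurable]
  obtain d :: "nat \<Rightarrow> 'y" where d: "\<And>x e. e > 0 \<Longrightarrow> \<exists>i. dist x (d i) < e"
    using dense_sequence by blast
  define \<nu> where "\<nu> k e = (LEAST j. dist (\<psi> e) (d j) < 1 / 2 ^ k)" for k e
  have \<nu>_dist: "dist (\<psi> e) (d (\<nu> k e)) < 1 / 2 ^ k" for k e
    unfolding \<nu>_def by (rule LeastI_ex[OF d]) simp
  have [measurable]: "\<nu> k \<in> borel \<rightarrow>\<^sub>M count_space UNIV" for k
    unfolding \<nu>_def by measurable
  have "borel_separated (\<phi> ` {e \<in> Q. \<nu> k e = j}) (\<phi> ` {e \<in> Q. \<nu> k e \<noteq> j})" for k j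
  proof (rule lusin_separation[OF _ _ \<phi>])
    have "{e \<in> space borel. e \<in> Q \<and> \<nu> k e = j} \<in> sets borel"
         "{e \<in> space borel. e \<in> Q \<and> \<nu> k e \<noteq> j} \<in> sets borel" by measurable
    then show "{e \<in> Q. \<nu> k e = j} \<in> sets borel" "{e \<in> Q. \<nu> k e \<noteq> j} \<in> sets borel"
      by simp_all
    show "\<phi> ` {e \<in> Q. \<nu> k e = j} \<inter> \<phi> ` {e \<in> Q. \<nu> k e \<noteq> j} = {}"
    proof (rule ccontr)
      assume "\<not> ?thesis"
      then obtain e e' where "e \<in> Q" "e' \<in> Q" "\<nu> k e = j" "\<nu> k e' \<noteq> j" "\<phi> e = \<phi> e'" by blast
      with det[of e e'] show False by (simp add: \<nu>_def)
    qed
  qed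
  then have "\<forall>k j. \<exists>D\<in>sets borel. \<phi> ` {e \<in> Q. \<nu> k e = j} \<subseteq> D \<and> D \<inter> \<phi> ` {e \<in> Q. \<nu> k e \<noteq> j} = {}"
    unfolding borel_separated_def by blast
  then obtain B where B: "\<forall>k j. B k j \<in> sets borel \<and> \<phi> ` {e \<in> Q. \<nu> k e = j} \<subseteq> B k j \<and>
      B k j \<inter> \<phi> ` {e \<in> Q. \<nu> k e \<noteq> j} = {}"
    unfolding Bex_def choice_iff by (elim exE)
  have [measurable]: "B k j \<in> sets borel" and B1: "\<phi> ` {e \<in> Q. \<nu> k e = j} \<subseteq> B k j"
    and B2: "B k j \<inter> \<phi> ` {e \<in> Q. \<nu> k e \<noteq> j} = {}" for k j
    using B by blast+
  define g where "g k x = d (LEAST j. x \<in> B k j)" for k x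
  have [measurable]: "g k \<in> borel_measurable borel" for k
    unfolding g_def by measurable
  have g: "g k (\<phi> e) = d (\<nu> k e)" if "e \<in> Q" for k e
  proof -
    have "\<phi> e \<in> B k j \<longleftrightarrow> j = \<nu> k e" for j
      using B1[of k j] B2[of k j] that by blast
    moreover have "(LEAST j. j = \<nu> k e) = \<nu> k e" by (rule Least_equality) auto
    ultimately show ?thesis unfolding g_def by simp
  qed
  \<comment> \<open>Off the image of \<open>Q\<close> the approximations need not converge. Using
    the constant \<open>d 0\<close> wherever they are not Cauchy makes the limit exist
    everywhere.\<close>
  define g' where "g' k x = (if Cauchy (\<lambda>k. g k x) then g k x else d 0)" for k x
  define h where "h x = lim (\<lambda>k. g' k x)" for x
  have "convergent (\<lambda>k. g' k x)" for x
    by (cases "Cauchy (\<lambda>k. g k x)") (simp_all add: g'_def Cauchy_convergent convergent_const)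
  then have g'_lim: "(\<lambda>k. g' k x) \<longlonglongrightarrow> h x" for x
    unfolding h_def by (simp add: convergent_LIMSEQ_iff)
  have g'_meas: "g' k \<in> borel_measurable borel" for k
  proof -
    have [measurable]: "Measurable.pred borel (\<lambda>x. Cauchy (\<lambda>k. g k x))"
      using sets_Collect_Cauchy[of g borel] by (simp add: pred_def)
    show ?thesis unfolding g'_def by measurable
  qed
  have "h \<in> borel_measurable borel"
    by (rule borel_measurable_LIMSEQ_metric[of g', OF g'_meas g'_lim])
  moreover have "h (\<phi> e) = \<psi> e" if e: "e \<in> Q" for e
  proof -
    have "(\<lambda>k. 1 / 2 ^ k :: real) \<longlonglongrightarrow> 0"
      using LIMSEQ_realpow_zero[of "1/2"] by (simp add: power_one_over)
    then have "(\<lambda>k. dist (g k (\<phi> e)) (\<psi> e)) \<longlonglongrightarrow> 0"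
    proof (rule real_tendsto_sandwich[OF always_eventually always_eventually tendsto_const, rotated 2])
      show "\<forall>k. 0 \<le> dist (g k (\<phi> e)) (\<psi> e)" by simp
      show "\<forall>k. dist (g k (\<phi> e)) (\<psi> e) \<le> 1 / 2 ^ k"
      proof
        fix k
        show "dist (g k (\<phi> e)) (\<psi> e) \<le> 1 / 2 ^ k"
          using \<nu>_dist[of e k] g[OF e, of k] by (simp only: dist_commute less_imp_le)
      qed
    qed
    then have lim: "(\<lambda>k. g k (\<phi> e)) \<longlonglongrightarrow> \<psi> e"
      by (subst tendsto_dist_iff)
    then have "Cauchy (\<lambda>k. g k (\<phi> e))" by (rule LIMSEQ_imp_Cauchy)
    then show ?thesis using lim unfolding h_def g'_def by (simp add: limI)
  qed
  ultimately show thesis using that by blast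
qed

section \<open>The Lusin-Novikov theorem\<close>

text \<open>By \<open>split\<close>, every fibre of \<open>q\<close> in \<open>L\<close> is closed
  without interior relative to \<open>L\<close>; by the Baire category theorem countably many such
  fibres cannot cover the nonempty \<open>L\<close>.\<close>

lemma uncountable_image_closed:
  fixes L :: "'c::polish_space set" and q :: "'c \<Rightarrow> 'y::t1_space"
  assumes L: "closed L" "L \<noteq> {}" and q: "continuous_on UNIV q"
    and split: "\<And>U. open U \<Longrightarrow> U \<inter> L \<noteq> {} \<Longrightarrow> \<exists>a\<in>U \<inter> L. \<exists>b\<in>U \<inter> L. q a \<noteq> q b"
  shows "uncountable (q ` L)"
proof
  assume count: "countable (q ` L)"
  let ?X = "top_of_set L"
  define F where "F y = L \<inter> q -` {y}" for y
  have "?X interior_of \<Union> (F ` q ` L) = {}"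
  proof (rule Baire_category_alt)
    show "completely_metrizable_space ?X \<or> locally_compact_space ?X \<and> regular_space ?X"
      using L completely_metrizable_space_closedin[OF completely_metrizable_space_euclidean, of L]
      by simp
    show "countable (F ` q ` L)" using count by blast
    fix T assume "T \<in> F ` q ` L"
    then obtain y where T: "T = F y" by blast
    have "closed (q -` {y})" by (rule closed_vimage) (use q in auto)
    then have "closedin ?X T" unfolding T F_def by (simp add: closedin_closed_Int)
    moreover have "W = {}" if W: "openin ?X W" "W \<subseteq> T" for W
    proof (rule ccontr)
      assume "W \<noteq> {}"
      obtain U where U: "open U" "W = U \<inter> L" using W(1) by (auto simp: openin_open)
      then obtain a b where "a \<in> W" "b \<in> W" "q a \<noteq> q b" using split[of U] \<open>W \<noteq> {}\<close> by blast
      then show False using W(2) unfolding T F_def by blast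
    qed
    ultimately show "closedin ?X T \<and> ?X interior_of T = {}"
      by (simp add: interior_of_eq_empty)
  qed
  moreover have "\<Union> (F ` q ` L) = topspace ?X" unfolding F_def by auto
  ultimately show False using L(2) interior_of_topspace[of ?X] by simp
qed

text \<open>
  A list \<open>a\<close> of basic open sets is an approximation to finitely many points of \<open>K\<close> with a common
  value under \<open>p\<close>, and \<open>conf a H\<close> consists of the tuples of such points, none of them lying on the
  graph of a function in \<open>H\<close>.  The countable family \<open>H\<close> of Borel functions is chosen so large that
  \<open>conf a H\<close> is empty whenever any countable family achieves this.  By Borel factorization, a
  nonempty \<open>conf a H\<close> then has, for each index \<open>j\<close>, two members with the same value of \<open>p\<close> that
  differ in \<open>q\<close> at \<open>j\<close>; so a point can always be split.  If the graphs did not cover, then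
  repeated splitting would produce in the limit a closed set, dense in itself with respect to \<open>q\<close>,
  inside one fibre of \<open>p\<close>, against countability of the fibres.
\<close>

lemma lusin_novikov_closed:
  fixes K :: "'c::polish_space set" and p :: "'c \<Rightarrow> 'x::polish_space" and q :: "'c \<Rightarrow> 'y::polish_space"
  assumes K: "closed K" and p: "continuous_on UNIV p" and q: "continuous_on UNIV q"
    and count: "\<And>x. countable (q ` (K \<inter> p -` {x}))"
  obtains H where "countable H" "H \<subseteq> borel_measurable borel" "\<And>e. e \<in> K \<Longrightarrow> \<exists>h\<in>H. q e = h (p e)"
proof -
  obtain \<B> :: "'c set set" where \<B>: "countable \<B>" "topological_basis \<B>"
    using ex_countable_basis by blast
  \<comment> \<open>Tuples are total functions of which only the first \<open>length a\<close>
    coordinates are constrained, so that all these sets live in one Polish space whatever the length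
    of \<open>a\<close>.\<close>
  define conf where "conf a H = {e :: nat \<Rightarrow> 'c. \<forall>i<length a. e i \<in> K \<and> e i \<in> a ! i \<and> p (e i) = p (e 0) \<and>
     (\<forall>h\<in>H. q (e i) \<noteq> h (p (e i)))}" for a H
  define small where "small a \<longleftrightarrow> (\<exists>H. countable H \<and> H \<subseteq> borel_measurable borel \<and> conf a H = {})" for a
  have conf_mono: "conf a H' \<subseteq> conf a H" if "H \<subseteq> H'" for a H H'
    using that unfolding conf_def by blast
  define G where "G a = (SOME H. countable H \<and> H \<subseteq> borel_measurable borel \<and> conf a H = {})" for a
  have G: "countable (G a)" "G a \<subseteq> borel_measurable borel" "conf a (G a) = {}" if "small a" for a
    using someI_ex[OF that[unfolded small_def]] unfolding G_def by blast+
  \<comment> \<open>There are only countably many lists over a countable basis, so one countable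
    family serves all small lists at once.\<close>
  define H where "H = (\<Union>a \<in> {a \<in> lists \<B>. small a}. G a)"
  have H: "countable H" "H \<subseteq> borel_measurable borel"
    unfolding H_def using G(1,2) \<B>(1) by (auto intro!: countable_UN countable_Collect countable_lists)
  have not_small: "\<not> small a" if "a \<in> lists \<B>" "conf a H \<noteq> {}" for a
    using that conf_mono[of "G a" H a] G(3)[of a] unfolding H_def by blast
  have p_meas: "p \<in> borel_measurable borel" and q_meas: "q \<in> borel_measurable borel"
    using p q by (auto intro: borel_measurable_continuous_onI)
  have coord: "(\<lambda>e :: nat \<Rightarrow> 'c. e i) \<in> borel_measurable borel" for i
    by (intro borel_measurable_continuous_onI continuous_on_product_coordinates)
  note p_coord = measurable_compose[OF coord p_meas] and q_coord = measurable_compose[OF coord q_meas]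
  have conf_borel: "conf a H \<in> sets borel" if "a \<in> lists \<B>" for a
  proof -
    have "{e \<in> space borel. \<forall>i\<in>{..<length a}. e i \<in> K \<and> e i \<in> a ! i \<and> p (e i) = p (e 0) \<and>
       (\<forall>h\<in>H. q (e i) \<noteq> h (p (e i)))} \<in> sets borel"
    proof (intro sets.sets_Collect_countable_All' sets.sets_Collect_conj
        countable_finite[OF finite_lessThan] H(1))
      fix i assume i: "i \<in> {..<length a}"
      have "K \<in> sets borel" using K by simp
      from measurable_sets[OF coord this]
      show "{e \<in> space borel. e i \<in> K} \<in> sets borel" by (simp add: vimage_def)
      have "a ! i \<in> sets borel"
        using that i \<B>(2) by (auto simp: in_lists_conv_set topological_basis_open)
      from measurable_sets[OF coord this]
      show "{e \<in> space borel. e i \<in> a ! i} \<in> sets borel" by (simp add: vimage_def)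
      show "{e \<in> space borel. p (e i) = p (e 0)} \<in> sets borel"
        by (rule measurable_equality_set[OF p_coord p_coord])
      fix h assume "h \<in> H"
      with H(2) have "h \<in> borel_measurable borel" by (rule subsetD)
      from sets.sets_Collect_neg[OF measurable_equality_set[OF q_coord measurable_compose[OF p_coord this]]]
      show "{e \<in> space borel. q (e i) \<noteq> h (p (e i))} \<in> sets borel" .
    qed
    moreover have "conf a H = {e \<in> space borel. \<forall>i\<in>{..<length a}. e i \<in> K \<and> e i \<in> a ! i \<and>
       p (e i) = p (e 0) \<and> (\<forall>h\<in>H. q (e i) \<noteq> h (p (e i)))}"
      unfolding conf_def space_borel by blast
    ultimately show ?thesis by (simp only:)
  qed
  have splits: "\<exists>e\<in>conf a H. \<exists>e'\<in>conf a H. p (e 0) = p (e' 0) \<and> q (e j) \<noteq> q (e' j)"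
    if a: "a \<in> lists \<B>" "conf a H \<noteq> {}" and j: "j < length a" for a j
  proof (rule ccontr)
    assume "\<not> ?thesis"
    then obtain h where h: "h \<in> borel_measurable borel" "\<And>e. e \<in> conf a H \<Longrightarrow> h (p (e 0)) = q (e j)"
      using borel_factorization[OF conf_borel[OF a(1)] p_coord q_coord, of 0 j] by blast
    \<comment> \<open>On \<open>conf a H\<close> the function \<open>h\<close> predicts
      \<open>q (e j)\<close> from the common value of \<open>p\<close>. Adding it to the family
      excludes every tuple, so \<open>a\<close> would be small.\<close>
    have False if "e \<in> conf a (insert h H)" for e
    proof -
      have "e \<in> conf a H" using that conf_mono[of H "insert h H" a] by blast
      then have "h (p (e 0)) = q (e j)" by (rule h(2))
      moreover have "q (e j) \<noteq> h (p (e j))" "p (e j) = p (e 0)"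
        using that j unfolding conf_def by blast+
      ultimately show False by simp
    qed
    then have "conf a (insert h H) = {}" by blast
    then have "small a" unfolding small_def using h(1) H by (intro exI[of _ "insert h H"]) auto
    then show False using not_small a by blast
  qed
  have step: "\<exists>b. b \<in> lists \<B> \<and> conf b H \<noteq> {} \<and> length b = Suc (length a) \<and>
      (\<forall>i<length a. b ! i \<subseteq> a ! i) \<and> b ! length a \<subseteq> a ! j \<and>
      (\<forall>i<length b. \<forall>x\<in>b ! i. \<forall>y\<in>b ! i. dist x y < \<epsilon>) \<and>
      (\<forall>x\<in>closure (b ! j). \<forall>y\<in>closure (b ! length a). q x \<noteq> q y)"
    if a: "a \<in> lists \<B>" "conf a H \<noteq> {}" and j: "j < length a" and \<epsilon>: "\<epsilon> > 0" for a j and \<epsilon> :: real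
  proof -
    let ?m = "length a"
    obtain e e' where e: "e \<in> conf a H" "e' \<in> conf a H" "p (e 0) = p (e' 0)" "q (e j) \<noteq> q (e' j)"
      using splits[OF a j] by blast
    \<comment> \<open>Both tuples lie over the same value of \<open>p\<close>, so the
      \<open>j\<close>-th point of \<open>e'\<close> can be appended to \<open>e\<close> as a second
      descendant of the piece \<open>a ! j\<close>.\<close>
    define f where "f i = (if i < ?m then e i else e' j)" for i
    define A where "A i = (if i < ?m then a ! i else a ! j)" for i
    obtain U V where UV: "open U" "open V" "q (e j) \<in> U" "q (e' j) \<in> V" "U \<inter> V = {}"
      using hausdorff[OF e(4)] by blast
    have "open (q -` U)" "open (q -` V)" using UV q by (simp_all add: open_vimage)
    then obtain r s where rs: "r > 0" "cball (e j) r \<subseteq> q -` U" "s > 0" "cball (e' j) s \<subseteq> q -` V"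
      using UV by (metis open_contains_cball vimageI)
    \<comment> \<open>The bound \<open>\<epsilon> / 2\<close> controls diameters; \<open>r\<close>
      and \<open>s\<close> keep even the closures of the two descendants inside the preimages of
      \<open>U\<close> and \<open>V\<close>, so that \<open>q\<close> still separates limit
      points.\<close>
    define \<rho> where "\<rho> = min (\<epsilon> / 2) (min r s)"
    have \<rho>: "\<rho> > 0" "\<rho> \<le> \<epsilon> / 2" "\<rho> \<le> r" "\<rho> \<le> s" unfolding \<rho>_def using \<epsilon> rs by auto
    have "\<exists>b\<in>\<B>. f i \<in> b \<and> b \<subseteq> ball (f i) \<rho> \<inter> A i" if "i \<le> ?m" for i
    proof -
      have "open (A i)" using a(1) j that \<B>(2) unfolding A_def
        by (auto simp: in_lists_conv_set topological_basis_open)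
      then have "open (ball (f i) \<rho> \<inter> A i)" by (intro open_Int open_ball)
      moreover have "f i \<in> A i" using e j unfolding f_def A_def conf_def by auto
      then have "f i \<in> ball (f i) \<rho> \<inter> A i" using \<rho>(1) by simp
      ultimately show ?thesis by (rule topological_basisE[OF \<B>(2)]) blast
    qed
    then obtain g where g: "\<And>i. i \<le> ?m \<Longrightarrow> g i \<in> \<B>" "\<And>i. i \<le> ?m \<Longrightarrow> f i \<in> g i"
       "\<And>i. i \<le> ?m \<Longrightarrow> g i \<subseteq> ball (f i) \<rho>" "\<And>i. i \<le> ?m \<Longrightarrow> g i \<subseteq> A i"
      by (metis le_inf_iff)
    define b where "b = map g [0..<Suc ?m]"
    have b_nth: "b ! i = g i" if "i \<le> ?m" for i
      using that unfolding b_def by (simp del: upt_Suc)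
    have len: "length b = Suc ?m" unfolding b_def by simp
    have e_conf: "e i \<in> K" "p (e i) = p (e 0)" "\<forall>h\<in>H. q (e i) \<noteq> h (p (e i))"
      "e' i \<in> K" "p (e' i) = p (e' 0)" "\<forall>h\<in>H. q (e' i) \<noteq> h (p (e' i))" if "i < ?m" for i
      using e(1,2) that unfolding conf_def by blast+
    have f0: "f 0 = e 0" using j unfolding f_def by (auto split: if_split)
    have "p (f i) = p (f 0) \<and> f i \<in> K \<and> (\<forall>h\<in>H. q (f i) \<noteq> h (p (f i)))" for i
    proof (cases "i < ?m")
      case True
      then show ?thesis using e_conf(1-3)[OF True] unfolding f0 by (simp add: f_def)
    next
      case False
      then show ?thesis using e_conf(4-6)[OF j] e(3) unfolding f0 by (simp add: f_def)
    qed
    moreover have "i < length b \<longleftrightarrow> i \<le> ?m" for i unfolding len by (rule less_Suc_eq_le)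
    ultimately have "f \<in> conf b H" unfolding conf_def using b_nth g(2) by blast
    moreover have "b \<in> lists \<B>" using g(1) unfolding b_def by auto
    moreover have "\<forall>i<?m. b ! i \<subseteq> a ! i" using g(4) b_nth unfolding A_def by (metis less_imp_le)
    moreover have "b ! ?m \<subseteq> a ! j" using g(4)[of ?m] b_nth unfolding A_def by simp
    moreover have "dist x y < \<epsilon>" if "i < length b" "x \<in> b ! i" "y \<in> b ! i" for i x y
    proof -
      have "i \<le> ?m" using that len by simp
      then have "dist (f i) x < \<rho>" "dist (f i) y < \<rho>"
        using g(3)[of i] b_nth[of i] that by auto
      then show ?thesis using dist_triangle3[of x y "f i"] \<rho>(2) by linarith
    qed
    moreover have "q x \<noteq> q y" if "x \<in> closure (b ! j)" "y \<in> closure (b ! ?m)" for x y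
    proof -
      have "closure (b ! i) \<subseteq> cball (f i) \<rho>" if "i \<le> ?m" for i
        using g(3)[OF that] b_nth[OF that] by (intro closure_minimal) auto
      then have "x \<in> cball (f j) \<rho>" "y \<in> cball (f ?m) \<rho>"
        using that less_imp_le[OF j] by blast+
      then have "x \<in> cball (e j) r" "y \<in> cball (e' j) s"
        using \<rho>(3,4) j unfolding f_def by simp_all
      then show ?thesis using rs(2,4) UV(5) by (metis disjoint_iff subsetD vimageE)
    qed
    ultimately show ?thesis using len by (intro exI[of _ b]) blast
  qed
  have "\<exists>h\<in>H. q e = h (p e)" if "e \<in> K" for e
  proof (rule ccontr)
    assume nocover: "\<not> ?thesis"
    obtain b where b: "b \<in> \<B>" "e \<in> b"
      using topological_basisE[OF \<B>(2) open_UNIV] by blast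
    \<comment> \<open>By the pairing function every index is split at infinitely many stages, and
      \<open>j n \<le> n\<close> guarantees that the piece to be split at stage \<open>n\<close>
      already exists.\<close>
    define j where "j n = snd (prod_decode n)" for n
    have j_le: "j n \<le> n" for n unfolding j_def
      by (metis le_prod_encode_2 prod.collapse prod_decode_inverse)
    have j_inf: "\<exists>n\<ge>N. j n = i" for i N unfolding j_def
      by (rule exI[of _ "prod_encode (N, i)"]) (simp add: le_prod_encode_1)
    let ?P = "\<lambda>n a. a \<in> lists \<B> \<and> conf a H \<noteq> {} \<and> length a = Suc n"
    let ?Q = "\<lambda>n a b. (\<forall>i<length a. b ! i \<subseteq> a ! i) \<and> b ! length a \<subseteq> a ! j n \<and>
      (\<forall>i<length b. \<forall>x\<in>b ! i. \<forall>y\<in>b ! i. dist x y < 1 / 2 ^ n) \<and>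
      (\<forall>x\<in>closure (b ! j n). \<forall>y\<in>closure (b ! length a). q x \<noteq> q y)"
    have "\<exists>a. \<forall>n. ?P n (a n) \<and> ?Q n (a n) (a (Suc n))"
    proof (rule dependent_nat_choice)
      have "(\<lambda>_. e) \<in> conf [b] H" using \<open>e \<in> K\<close> b nocover by (auto simp: conf_def)
      then show "\<exists>a. ?P 0 a" using b by (intro exI[of _ "[b]"]) auto
    next
      fix a n assume "?P n a"
      then show "\<exists>b. ?P (Suc n) b \<and> ?Q n a b"
        using step[of a "j n" "1 / 2 ^ n"] j_le[of n] by (simp add: less_Suc_eq_le)
    qed
    then obtain a where aQ: "\<forall>n. ?P n (a n) \<and> ?Q n (a n) (a (Suc n))" ..
    have len: "length (a n) = Suc n" for n using aQ by blast
    have Q1: "a (Suc n) ! i \<subseteq> a n ! i" if "i \<le> n" for i n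
      using aQ that len[of n] by (metis less_Suc_eq_le)
    have Q2: "a (Suc n) ! Suc n \<subseteq> a n ! j n" for n
      using aQ len[of n] by metis
    have Q3: "dist x y < 1 / 2 ^ n" if "i \<le> Suc n" "x \<in> a (Suc n) ! i" "y \<in> a (Suc n) ! i" for i n x y
      using aQ that len[of "Suc n"] by (metis less_Suc_eq_le)
    have Q4: "q x \<noteq> q y" if "x \<in> closure (a (Suc n) ! j n)" "y \<in> closure (a (Suc n) ! Suc n)" for n x y
      using aQ that len[of n] by metis
    have "\<exists>e. e \<in> conf (a n) H" for n using aQ by blast
    then obtain \<gamma> where \<gamma>: "\<And>n. \<gamma> n \<in> conf (a n) H" by metis
    have \<gamma>K: "\<gamma> n i \<in> K" and \<gamma>a: "\<gamma> n i \<in> a n ! i" and \<gamma>p: "p (\<gamma> n i) = p (\<gamma> n 0)" if "i \<le> n" for n i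
    proof -
      have "i < length (a n)" using len[of n] that by simp
      with \<gamma>[of n] show "\<gamma> n i \<in> K" "\<gamma> n i \<in> a n ! i" "p (\<gamma> n i) = p (\<gamma> n 0)"
        unfolding conf_def by blast+
    qed
    have anti: "a n ! i \<subseteq> a m ! i" if "i \<le> m" "m \<le> n" for i m n
      using that(2)
    proof (induction n rule: dec_induct)
      case (step n)
      have "a (Suc n) ! i \<subseteq> a n ! i" using Q1 step that by simp
      then show ?case using step by blast
    qed simp
    have diam: "dist x y < 1 / 2 ^ n" if "x \<in> a m ! i" "y \<in> a m ! i" "i \<le> n" "n < m" for x y i m n
    proof -
      have "i \<le> Suc n" "Suc n \<le> m" using that by simp_all
      with anti[OF this] show ?thesis using Q3 that(1,2) by blast
    qed
    have small_eps: "\<exists>n\<ge>N. 1 / 2 ^ n < \<epsilon>" if "\<epsilon> > 0" for \<epsilon> :: real and N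
    proof -
      obtain n where "(1 / 2) ^ n < \<epsilon>" using real_arch_pow_inv[of \<epsilon> "1/2"] \<open>\<epsilon> > 0\<close> by auto
      moreover have "(1 / 2 :: real) ^ max n N \<le> (1 / 2) ^ n" by (rule power_decreasing) auto
      ultimately have "1 / 2 ^ max n N < \<epsilon>" by (simp add: power_one_over)
      then show ?thesis by (intro exI[of _ "max n N"]) simp
    qed
    have "convergent (\<lambda>n. \<gamma> n i)" for i
    proof (intro Cauchy_convergent metric_CauchyI)
      fix \<epsilon> :: real assume "\<epsilon> > 0"
      then obtain n where n: "n \<ge> i" "1 / 2 ^ n < \<epsilon>" using small_eps by blast
      have "dist (\<gamma> m i) (\<gamma> l i) < \<epsilon>" if "m \<ge> Suc n" "l \<ge> Suc n" for m l
      proof -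
        have "\<gamma> m i \<in> a (Suc n) ! i" "\<gamma> l i \<in> a (Suc n) ! i"
          using \<gamma>a[of i m] \<gamma>a[of i l] anti[of i "Suc n" m] anti[of i "Suc n" l] n that by auto
        then show ?thesis using diam[of _ "Suc n" i _ n] n by fastforce
      qed
      then show "\<exists>M. \<forall>m\<ge>M. \<forall>n\<ge>M. dist (\<gamma> m i) (\<gamma> n i) < \<epsilon>" by blast
    qed
    then obtain z where z: "\<And>i. (\<lambda>n. \<gamma> n i) \<longlonglongrightarrow> z i" unfolding convergent_def by metis
    have zK: "z i \<in> K" for i
    proof (rule Lim_in_closed_set[OF K _ _ z])
      show "\<forall>\<^sub>F n in sequentially. \<gamma> n i \<in> K"
        unfolding eventually_sequentially using \<gamma>K by blast
    qed simp
    have zcl: "z i \<in> closure (a n ! i)" if "i \<le> n" for i n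
    proof (rule Lim_in_closed_set[OF closed_closure _ _ z])
      have "\<gamma> m i \<in> closure (a n ! i)" if "n \<le> m" for m
        using \<gamma>a[of i m] anti[OF \<open>i \<le> n\<close> that] \<open>i \<le> n\<close> that closure_subset[of "a n ! i"]
        by (meson le_trans subsetD)
      then show "\<forall>\<^sub>F m in sequentially. \<gamma> m i \<in> closure (a n ! i)"
        unfolding eventually_sequentially by blast
    qed simp
    \<comment> \<open>At stage \<open>n\<close> the values of \<open>p\<close> agree for all indices
      up to \<open>n\<close>, hence for a fixed \<open>i\<close> eventually; in the limit all
      \<open>z i\<close> lie in one fibre of \<open>p\<close>.\<close>
    have zp: "p (z i) = p (z 0)" for i
    proof (rule LIMSEQ_unique)
      have "isCont p x" for x using p by (simp add: continuous_on_eq_continuous_at)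
      then show "(\<lambda>n. p (\<gamma> n i)) \<longlonglongrightarrow> p (z i)" using isCont_tendsto_compose z by blast
      have "(\<lambda>n. p (\<gamma> n 0)) \<longlonglongrightarrow> p (z 0)"
        using isCont_tendsto_compose z \<open>\<And>x. isCont p x\<close> by blast
      moreover have "\<forall>\<^sub>F n in sequentially. p (\<gamma> n 0) = p (\<gamma> n i)"
        unfolding eventually_sequentially by (rule exI[of _ i]) (use \<gamma>p in metis)
      ultimately show "(\<lambda>n. p (\<gamma> n i)) \<longlonglongrightarrow> p (z 0)" by (rule Lim_transform_eventually)
    qed
    let ?L = "closure (range z)"
    have "uncountable (q ` ?L)"
    proof (rule uncountable_image_closed[OF closed_closure _ q])
      fix U :: "'c set" assume U: "open U" "U \<inter> ?L \<noteq> {}"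
      then obtain i where "z i \<in> U" using open_Int_closure_eq_empty[of U "range z"] by blast
      then obtain \<epsilon> where \<epsilon>: "\<epsilon> > 0" "ball (z i) \<epsilon> \<subseteq> U" using U(1) open_contains_ball by blast
      then obtain n0 where n0: "n0 \<ge> i" "1 / 2 ^ n0 < \<epsilon>" using small_eps by blast
      \<comment> \<open>At a stage beyond \<open>n0\<close> the piece at \<open>i\<close> is already
        small, so splitting it there yields a new limit point that stays in \<open>U\<close> but
        differs from \<open>z i\<close> under \<open>q\<close>.\<close>
      obtain n where n: "n \<ge> Suc n0" "j n = i" using j_inf by blast
      have "i \<le> Suc n" using n n0 by simp
      have "a (Suc n) ! Suc n \<subseteq> a n ! i" "q (z i) \<noteq> q (z (Suc n))"
        using Q2[of n] Q4[of "z i" n "z (Suc n)"] n(2) zcl[OF \<open>i \<le> Suc n\<close>] zcl[of "Suc n" "Suc n"] by simp_all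
      then have "z (Suc n) \<in> closure (a n ! i)"
        using zcl[of "Suc n" "Suc n"] closure_mono by blast
      moreover have "z i \<in> closure (a n ! i)" using zcl[of i n] n n0 by simp
      moreover have "dist x y \<le> 1 / 2 ^ n0" if "x \<in> closure (a n ! i)" "y \<in> closure (a n ! i)" for x y
      proof -
        have "dist x' y' \<le> 1 / 2 ^ n0" if "x' \<in> a n ! i" "y' \<in> a n ! i" for x' y'
          using diam[of x' n i y' n0] that n n0 by auto
        then have "a n ! i \<subseteq> cball x' (1 / 2 ^ n0)" if "x' \<in> a n ! i" for x' using that by auto
        then have "closure (a n ! i) \<subseteq> cball x' (1 / 2 ^ n0)" if "x' \<in> a n ! i" for x'
          using that by (simp add: closure_minimal)
        then have "a n ! i \<subseteq> cball y (1 / 2 ^ n0)" using \<open>y \<in> _\<close> by (force simp: dist_commute)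
        then have "closure (a n ! i) \<subseteq> cball y (1 / 2 ^ n0)" by (simp add: closure_minimal)
        then show ?thesis using \<open>x \<in> _\<close> by (auto simp: dist_commute)
      qed
      ultimately have "dist (z i) (z (Suc n)) < \<epsilon>" using n0 by (meson le_less_trans)
      then have "z (Suc n) \<in> U \<inter> ?L" using \<epsilon>(2) closure_subset by fastforce
      moreover have "z i \<in> U \<inter> ?L" using \<open>z i \<in> U\<close> closure_subset by fastforce
      ultimately show "\<exists>a\<in>U \<inter> ?L. \<exists>b\<in>U \<inter> ?L. q a \<noteq> q b" using \<open>q (z i) \<noteq> q (z (Suc n))\<close> by blast
    qed auto
    moreover have "?L \<subseteq> K \<inter> p -` {p (z 0)}"
    proof (rule closure_minimal)
      show "range z \<subseteq> K \<inter> p -` {p (z 0)}" using zK zp by auto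
      show "closed (K \<inter> p -` {p (z 0)})" using K p by (intro closed_Int closed_vimage) auto
    qed
    ultimately show False using count[of "p (z 0)"] countable_subset image_mono by metis
  qed
  with H that show thesis by blast
qed

text \<open>The closed set \<open>C\<close> projecting onto \<open>R\<close> may have uncountable
  fibres over \<open>x\<close>, because a pair can have many witnesses; only the second coordinates
  are countable in number. This is why the closed version counts values of \<open>q\<close> rather
  than points of the fibre.\<close>

lemma lusin_novikov:
  fixes R :: "('x::polish_space \<times> 'y::polish_space) set"
  assumes R: "R \<in> sets borel" and count: "\<And>x. countable (R `` {x})"
  obtains h :: "nat \<Rightarrow> 'x \<Rightarrow> 'y"
  where "\<And>n. h n \<in> borel_measurable borel" "\<And>x y. (x, y) \<in> R \<Longrightarrow> \<exists>n. y = h n x"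
proof -
  obtain C :: "(('x \<times> 'y) \<times> (nat \<Rightarrow> real)) set" where C: "closed C" "R = fst ` C"
    using borel_closed_projection[OF R] by blast
  have "(\<lambda>c. snd (fst c)) ` (C \<inter> (\<lambda>c. fst (fst c)) -` {x}) \<subseteq> R `` {x}" for x
    unfolding C(2) by force
  then have "countable ((\<lambda>c. snd (fst c)) ` (C \<inter> (\<lambda>c. fst (fst c)) -` {x}))" for x
    using count countable_subset by blast
  then obtain H where H: "countable H" "H \<subseteq> borel_measurable borel"
    "\<And>c. c \<in> C \<Longrightarrow> \<exists>h\<in>H. snd (fst c) = h (fst (fst c))"
    using lusin_novikov_closed[OF C(1) continuous_on_fst[OF continuous_on_fst[OF continuous_on_id]]
        continuous_on_snd[OF continuous_on_fst[OF continuous_on_id]]] by blast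
  define H' where "H' = insert (\<lambda>_. undefined) H"
  have H': "countable H'" "H' \<noteq> {}" "H' \<subseteq> borel_measurable borel"
    using H unfolding H'_def by auto
  show thesis
  proof
    show "from_nat_into H' n \<in> borel_measurable borel" for n
      by (rule subsetD[OF H'(3) from_nat_into[OF H'(2)]])
    fix x y assume "(x, y) \<in> R"
    then obtain c where "c \<in> C" "fst c = (x, y)" unfolding C(2) by force
    then obtain h where "h \<in> H'" "y = h x" using H(3)[of c] unfolding H'_def by auto
    then show "\<exists>n. y = from_nat_into H' n x" using from_nat_into_surj[OF H'(1)] by metis
  qed
qed

section \<open>Transfer from Polish types to standard Borel spaces\<close>

text \<open>
  The distances from a dense sequence embed \<open>M\<close> into \<open>nat \<Rightarrow> real\<close>; the image is the set \<open>K\<close> of all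
  sequences that satisfy the triangle inequalities and have infimum \<open>0\<close>, which is visibly Borel.
\<close>

lemma standard_borel_retract:
  assumes M: "standard_borel M" and ne: "space M \<noteq> {}"
  obtains c :: "'a \<Rightarrow> nat \<Rightarrow> real" and g where
    "c \<in> borel_measurable M" "g \<in> borel \<rightarrow>\<^sub>M M" "\<And>x. x \<in> space M \<Longrightarrow> g (c x) = x"
proof -
  obtain X where X: "completely_metrizable_space X" "second_countable X" "topspace X = space M"
    "sets M = sigma_sets (space M) {U. openin X U}"
    using M unfolding standard_borel_def by blast
  obtain S d where S: "Metric_space S d" "Metric_space.mcomplete S d" "X = Metric_space.mtopology S d"
    using X(1) unfolding completely_metrizable_space_def by blast
  interpret Metric_space S d by (rule S(1))
  have space: "space M = S" using X(3) S(3) by simp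
  obtain D where D: "countable D" "D \<subseteq> S" "mtopology closure_of D = S"
    using second_countable_imp_separable_space[OF X(2)] unfolding separable_space_def S(3) by auto
  have D_ne: "D \<noteq> {}" using D(3) ne space by auto
  define s where "s = from_nat_into D"
  have s: "s i \<in> S" for i using from_nat_into[OF D_ne] D(2) unfolding s_def by blast
  have dense: "\<exists>i. d x (s i) < e" if xS: "x \<in> S" and e: "e > 0" for x e
  proof -
    have "x \<in> mtopology closure_of D" using D(3) xS by simp
    then obtain y where "y \<in> D" "y \<in> mball x e" using e unfolding metric_closure_of by blast
    then show ?thesis using from_nat_into_surj[OF D(1)] unfolding s_def by (metis in_mball)
  qed
  have open_sets: "U \<in> sets M" if "openin mtopology U" for U
    unfolding X(4) S(3) using that by (intro sigma_sets.Basic) simp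
  define c where "c x = (\<lambda>i. d x (s i))" for x
  have c_meas: "c \<in> borel_measurable M"
  proof (rule measurable_coordinatewise_then_product)
    fix i
    have "{x \<in> space M. d x (s i) < a} = mball (s i) a" for a
      using s unfolding space by (auto simp: commute)
    then show "(\<lambda>x. c x i) \<in> borel_measurable M"
      unfolding c_def borel_measurable_iff_less using open_sets[OF openin_mball] by simp
  qed
  define K where "K = {f :: nat \<Rightarrow> real. (\<forall>n m. \<bar>f n - f m\<bar> \<le> d (s n) (s m) \<and> d (s n) (s m) \<le> f n + f m) \<and>
     (\<forall>k. \<exists>n. f n < 1 / real (Suc k))}"
  have [measurable]: "(\<lambda>f :: nat \<Rightarrow> real. f i) \<in> borel_measurable borel" for i
    by (intro borel_measurable_continuous_onI continuous_on_product_coordinates)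
  have coord_less: "{f \<in> space borel. f i < e} \<in> sets (borel :: (nat \<Rightarrow> real) measure)" for i e
    by measurable
  have K_meas: "K \<in> sets borel"
  proof -
    have "{f \<in> space borel. (\<forall>n m. \<bar>f n - f m\<bar> \<le> d (s n) (s m) \<and> d (s n) (s m) \<le> f n + f m) \<and>
     (\<forall>k. \<exists>n. f n < 1 / real (Suc k))} \<in> sets (borel :: (nat \<Rightarrow> real) measure)"
      by measurable
    then show ?thesis unfolding K_def by simp
  qed
  have c_K: "c x \<in> K" if "x \<in> S" for x
  proof -
    have "\<bar>d x (s n) - d x (s m)\<bar> \<le> d (s n) (s m) \<and> d (s n) (s m) \<le> d x (s n) + d x (s m)" for n m
      using triangle[OF that s s, of n m] triangle[OF that s s, of m n] triangle[OF s that s, of n m]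
        commute[of x] commute[of "s n" "s m"] by simp
    moreover have "\<exists>n. d x (s n) < 1 / real (Suc k)" for k using dense[OF that] by simp
    ultimately show ?thesis unfolding K_def c_def by blast
  qed
  \<comment> \<open>Indices along which \<open>f\<close> tends to 0 give a Cauchy sequence, since
    \<open>d (s n) (s m) \<le> f n + f m\<close>. Its limit exists by completeness, and the
    inequalities defining \<open>K\<close> force its distances to be \<open>f\<close>.\<close>
  have c_surj: "\<exists>x\<in>S. c x = f" if f: "f \<in> K" for f
  proof -
    have f1: "\<bar>f n - f m\<bar> \<le> d (s n) (s m)" "d (s n) (s m) \<le> f n + f m" for n m
      using f unfolding K_def by blast+
    have "\<forall>k. \<exists>n. f n < 1 / real (Suc k)" using f unfolding K_def by blast
    then obtain \<nu> where \<nu>: "\<And>k. f (\<nu> k) < 1 / real (Suc k)" by metis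
    have f_nonneg: "f n \<ge> 0" for n using f1(2)[of n n] s[of n] by simp
    have f_lim: "(\<lambda>k. f (\<nu> k)) \<longlonglongrightarrow> 0"
    proof (rule real_tendsto_sandwich[OF always_eventually always_eventually tendsto_const])
      show "\<forall>k. 0 \<le> f (\<nu> k)" using f_nonneg by blast
      show "\<forall>k. f (\<nu> k) \<le> 1 / real (Suc k)" using \<nu> by (simp add: less_imp_le)
      show "(\<lambda>k. 1 / real (Suc k)) \<longlonglongrightarrow> 0"
        using LIMSEQ_inverse_real_of_nat by (simp add: inverse_eq_divide)
    qed
    have "MCauchy (\<lambda>k. s (\<nu> k))"
      unfolding MCauchy_def
    proof (intro conjI allI impI)
      show "range (\<lambda>k. s (\<nu> k)) \<subseteq> S" using s by blast
      fix \<epsilon> :: real assume "\<epsilon> > 0"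
      then have "\<forall>\<^sub>F k in sequentially. f (\<nu> k) < \<epsilon> / 2"
        by (intro order_tendstoD(2)[OF f_lim]) simp
      then obtain N where N: "\<And>k. k \<ge> N \<Longrightarrow> f (\<nu> k) < \<epsilon> / 2"
        unfolding eventually_sequentially by blast
      have "d (s (\<nu> k)) (s (\<nu> l)) < \<epsilon>" if "N \<le> k" "N \<le> l" for k l
        using N[OF that(1)] N[OF that(2)] f1(2)[of "\<nu> k" "\<nu> l"] by linarith
      then show "\<exists>N. \<forall>n n'. N \<le> n \<longrightarrow> N \<le> n' \<longrightarrow> d (s (\<nu> n)) (s (\<nu> n')) < \<epsilon>" by blast
    qed
    then obtain x where x: "limitin mtopology (\<lambda>k. s (\<nu> k)) x sequentially"
      using S(2) unfolding mcomplete_def by blast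
    then have xS: "x \<in> S" using limitin_topspace by fastforce
    have d_lim: "(\<lambda>k. d (s (\<nu> k)) x) \<longlonglongrightarrow> 0"
      using x limitin_metric_dist_null[of "\<lambda>k. s (\<nu> k)" x sequentially] by blast
    have "d x (s m) = f m" for m
    proof -
      have bound: "\<bar>d x (s m) - f m\<bar> \<le> d (s (\<nu> k)) x + f (\<nu> k)" for k
        using triangle[OF xS s[of "\<nu> k"] s[of m]] triangle[OF s xS s, of "\<nu> k" m]
          f1[of "\<nu> k" m] f1(1)[of m "\<nu> k"] commute[of x "s (\<nu> k)"] commute[of "s m" "s (\<nu> k)"] by linarith
      have "(\<lambda>k. d (s (\<nu> k)) x + f (\<nu> k)) \<longlonglongrightarrow> 0"
        using tendsto_add[OF d_lim f_lim] by simp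
      then have "\<bar>d x (s m) - f m\<bar> \<le> 0"
        by (rule LIMSEQ_le_const) (use bound in blast)
      then show ?thesis by simp
    qed
    then show ?thesis using xS unfolding c_def by blast
  qed
  have c_inj: "x = y" if x: "x \<in> S" and y: "y \<in> S" and eq: "c x = c y" for x y
  proof (rule ccontr)
    assume "x \<noteq> y"
    then have "d x y > 0" using x y by simp
    then obtain i where "d x (s i) < d x y / 2" using dense[OF x, of "d x y / 2"] by auto
    moreover have "d y (s i) = d x (s i)" using eq unfolding c_def by metis
    ultimately show False using triangle[OF x s[of i] y] commute[of "s i" y] by linarith
  qed
  obtain x0 where x0: "x0 \<in> S" using ne space by blast
  \<comment> \<open>The default \<open>x0\<close> keeps the values of \<open>g\<close> in the space
    for sequences outside \<open>K\<close> as well.\<close>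
  define g where "g f = (if f \<in> K then SOME x. x \<in> S \<and> c x = f else x0)" for f
  have g_K: "g f \<in> S \<and> c (g f) = f" if "f \<in> K" for f
  proof -
    have "\<exists>x. x \<in> S \<and> c x = f" using c_surj[OF that] by blast
    from someI_ex[OF this] show ?thesis unfolding g_def using that by simp
  qed
  have g_S: "g f \<in> S" for f using g_K[of f] x0 unfolding g_def by (cases "f \<in> K") simp_all
  have gc: "g (c x) = x" if "x \<in> S" for x
    using c_inj g_K[OF c_K[OF that]] that by blast
  have g_ball: "g -` mball (s i) e \<in> sets borel" for i e
  proof -
    have "g f \<in> mball (s i) e \<longleftrightarrow> (f \<in> K \<and> f i < e) \<or> (f \<notin> K \<and> x0 \<in> mball (s i) e)" for f
    proof (cases "f \<in> K")
      case True
      then have "f i = d (g f) (s i)" using g_K[of f] unfolding c_def by metis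
      then show ?thesis using True g_S s commute by simp
    next
      case False then show ?thesis by (simp add: g_def)
    qed
    then have "g -` mball (s i) e = {f \<in> space borel. (f \<in> K \<and> f i < e) \<or> (f \<notin> K \<and> x0 \<in> mball (s i) e)}"
      by (simp only: set_eq_iff vimage_eq mem_Collect_eq space_borel UNIV_I simp_thms)
    also have "\<dots> \<in> sets borel"
      by (intro sets.sets_Collect_disj sets.sets_Collect_conj sets.sets_Collect_neg
          sets.sets_Collect_const coord_less) (use K_meas in simp_all)
    finally show ?thesis .
  qed
  have "g \<in> borel \<rightarrow>\<^sub>M M"
  proof (rule measurable_sigma_sets[OF X(4)])
    show "{U. openin X U} \<subseteq> Pow (space M)" using openin_subset X(3) by blast
    show "g \<in> space borel \<rightarrow> space M" using g_S space by blast
    fix U assume "U \<in> {U. openin X U}"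
    then have U: "U \<subseteq> S" "\<And>x. x \<in> U \<Longrightarrow> \<exists>e>0. mball x e \<subseteq> U"
      unfolding S(3) by (auto simp: openin_mtopology)
    \<comment> \<open>The preimages under \<open>g\<close> are known to be Borel for balls centred
      at the dense sequence, so an open set is written as a countable union of such balls with radii
      \<open>1 / (k + 1)\<close>.\<close>
    define B where "B p = mball (s (fst p)) (1 / real (Suc (snd p)))" for p
    define I where "I = {p. B p \<subseteq> U}"
    have "U \<subseteq> (\<Union>p\<in>I. B p)"
    proof
      fix x assume xU: "x \<in> U"
      then have xS: "x \<in> S" using U(1) by blast
      obtain e where e: "e > 0" "mball x e \<subseteq> U" using U(2)[OF xU] by blast
      obtain k where k: "1 / real (Suc k) < e / 2"
        using reals_Archimedean[of "e / 2"] e(1) by (auto simp: inverse_eq_divide)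
      obtain i where i: "d x (s i) < 1 / real (Suc k)" using dense[OF xS, of "1 / real (Suc k)"] by auto
      have "mball (s i) (1 / real (Suc k)) \<subseteq> mball x e"
      proof
        fix y assume "y \<in> mball (s i) (1 / real (Suc k))"
        then have y: "y \<in> S" "d (s i) y < 1 / real (Suc k)" by simp_all
        have "d x y < e" using triangle[OF xS s y(1), of i] i y(2) k by linarith
        then show "y \<in> mball x e" using xS y(1) by simp
      qed
      then have "(i, k) \<in> I" unfolding I_def B_def using e(2) by simp
      moreover have "x \<in> B (i, k)" using xS s i by (simp add: B_def commute)
      ultimately show "x \<in> (\<Union>p\<in>I. B p)" by blast
    qed
    then have "U = (\<Union>p\<in>I. B p)" unfolding I_def by blast
    then have "g -` U \<inter> space borel = (\<Union>p\<in>I. g -` B p)"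
      unfolding space_borel by blast
    also have "\<dots> \<in> sets borel"
      unfolding B_def by (intro sets.countable_UN' countableI_type) (use g_ball in blast)
    finally show "g -` U \<inter> space borel \<in> sets borel" .
  qed
  with c_meas gc space that show thesis by blast
qed

text \<open>The retraction turns \<open>M\<close> into a measurable retract of the Polish type of
  real sequences: the relation is coded there through \<open>c\<close>, and the resulting functions
  are brought back by \<open>g\<close>.\<close>

lemma standard_borel_lusin_novikov:
  assumes M: "standard_borel M" and R: "R \<in> sets (M \<Otimes>\<^sub>M M)"
    and count: "\<And>x. x \<in> space M \<Longrightarrow> countable (R `` {x})"
  obtains h :: "nat \<Rightarrow> 'a \<Rightarrow> 'a"
  where "\<And>n. h n \<in> M \<rightarrow>\<^sub>M M" "\<And>x y. (x, y) \<in> R \<Longrightarrow> \<exists>n. y = h n x"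
proof (cases "space M = {}")
  case True
  then have "R = {}" using sets.sets_into_space[OF R] by (auto simp: space_pair_measure)
  then show thesis using that[of "\<lambda>_ x. x"] by simp
next
  case False
  obtain c :: "'a \<Rightarrow> nat \<Rightarrow> real" and g where c: "c \<in> borel_measurable M" and g: "g \<in> borel \<rightarrow>\<^sub>M M"
    and gc: "\<And>x. x \<in> space M \<Longrightarrow> g (c x) = x"
    using standard_borel_retract[OF M False] by blast
  \<comment> \<open>The second clause admits only the code \<open>c y\<close> of each
    \<open>y\<close>. Otherwise a section would be the full preimage under \<open>g\<close> of a
    countable set, which may be uncountable.\<close>
  define R' where "R' = {p. (g (fst p), g (snd p)) \<in> R \<and> c (g (snd p)) = snd p}"
  have "R' \<in> sets (borel \<Otimes>\<^sub>M borel)"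
  proof -
    have f: "(\<lambda>p. g (fst p)) \<in> (borel \<Otimes>\<^sub>M borel) \<rightarrow>\<^sub>M M" "(\<lambda>p. g (snd p)) \<in> (borel \<Otimes>\<^sub>M borel) \<rightarrow>\<^sub>M M"
      by (rule measurable_compose[OF measurable_fst g], rule measurable_compose[OF measurable_snd g])
    have "{p \<in> space (borel \<Otimes>\<^sub>M borel). (g (fst p), g (snd p)) \<in> R} \<in> sets (borel \<Otimes>\<^sub>M borel)"
      using measurable_sets[OF measurable_Pair[OF f] R] by (simp add: vimage_def space_pair_measure)
    moreover have "{p \<in> space (borel \<Otimes>\<^sub>M borel). c (g (snd p)) = snd p} \<in> sets (borel \<Otimes>\<^sub>M borel)"
      by (rule measurable_equality_set[OF measurable_compose[OF f(2) c] measurable_snd])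
    ultimately have "{p \<in> space (borel \<Otimes>\<^sub>M borel). (g (fst p), g (snd p)) \<in> R \<and> c (g (snd p)) = snd p}
        \<in> sets (borel \<Otimes>\<^sub>M borel)"
      by (rule sets.sets_Collect_conj[rotated])
    then show ?thesis unfolding R'_def by (simp add: space_pair_measure)
  qed
  then have R'_borel: "R' \<in> sets borel" unfolding borel_prod .
  have "countable (R' `` {f})" for f
  proof (rule countable_subset)
    show "R' `` {f} \<subseteq> c ` (R `` {g f})" unfolding R'_def by force
    show "countable (c ` (R `` {g f}))"
      using count[OF measurable_space[OF g]] by simp
  qed
  then obtain h :: "nat \<Rightarrow> (nat \<Rightarrow> real) \<Rightarrow> nat \<Rightarrow> real"
    where h: "\<And>n. h n \<in> borel_measurable borel" "\<And>x y. (x, y) \<in> R' \<Longrightarrow> \<exists>n. y = h n x"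
    using lusin_novikov[OF R'_borel] by blast
  show thesis
  proof (rule that[of "\<lambda>n x. g (h n (c x))"])
    show "(\<lambda>x. g (h n (c x))) \<in> M \<rightarrow>\<^sub>M M" for n
      by (rule measurable_compose[OF measurable_compose[OF c h(1)] g])
    fix x y assume xy: "(x, y) \<in> R"
    then have "x \<in> space M" "y \<in> space M" using sets.sets_into_space[OF R] by (auto simp: space_pair_measure)
    then have "(c x, c y) \<in> R'" unfolding R'_def using gc xy by simp
    then obtain n where "c y = h n (c x)" using h(2) by blast
    then show "\<exists>n. y = g (h n (c x))" using gc[OF \<open>y \<in> space M\<close>] by metis
  qed
qed

section \<open>Borel enumeration of the classes of a smooth countable equivalence relation\<close>

lemma locally_countable_component:
  assumes "locally_countable V G" "G \<subseteq> V \<times> V"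
  shows "countable (connected_rel V G `` {x})"
proof (rule countable_subset)
  show "connected_rel V G `` {x} \<subseteq> G\<^sup>* `` {x}" unfolding connected_rel_def by blast
  have "countable (G `` {y})" for y
  proof (cases "y \<in> V")
    case False
    then have "G `` {y} = {}" using assms(2) by blast
    then show ?thesis by simp
  qed (use assms(1) in \<open>simp add: locally_countable_def\<close>)
  then have image: "countable (G `` Y)" if "countable Y" for Y
    using that by (subst Image_eq_UN) (rule countable_UN)
  show "countable (G\<^sup>* `` {x})" by (rule countable_rtrancl[OF image]) simp_all
qed

lemma smooth_countable_equiv_enumeration:
  assumes M: "standard_borel M" and E: "smooth_equiv M E"
    and count: "\<And>x. x \<in> space M \<Longrightarrow> countable (E `` {x})"
  obtains g :: "nat \<Rightarrow> 'a \<Rightarrow> 'a" where "\<And>n. g n \<in> M \<rightarrow>\<^sub>M M"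
    "\<And>x. x \<in> space M \<Longrightarrow> \<exists>n. g n x = x" "\<And>n x y. (x, y) \<in> E \<Longrightarrow> g n x = g n y"
proof -
  have equiv: "equiv (space M) E" and E_sets: "E \<in> sets (M \<Otimes>\<^sub>M M)"
    using E unfolding smooth_equiv_def borel_equiv_def by blast+
  obtain T where T: "T \<in> sets M" "\<forall>C \<in> space M // E. \<exists>!x. x \<in> T \<inter> C"
    using E unfolding smooth_equiv_def borel_transversal_def by blast
  have E_sp: "x \<in> space M" "y \<in> space M" if "(x, y) \<in> E" for x y
    using that sets.sets_into_space[OF E_sets] by (auto simp: space_pair_measure)
  have E_refl: "(x, x) \<in> E" if "x \<in> space M" for x
    using equiv that unfolding equiv_def refl_on_def by blast
  have E_sym: "(y, x) \<in> E" if "(x, y) \<in> E" for x y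
    using equiv that unfolding equiv_def sym_def by blast
  have E_trans: "(x, z) \<in> E" if "(x, y) \<in> E" "(y, z) \<in> E" for x y z
    using equiv that unfolding equiv_def trans_def by blast
  have T_ex1: "\<exists>!t. t \<in> T \<inter> E `` {x}" if "x \<in> space M" for x
    using T(2) quotientI[OF that] by blast
  \<comment> \<open>\<open>R\<close> is the graph of the map onto the transversal. That this map is
    measurable takes a separate application of Lusin-Novikov: the representative of \<open>x\<close>
    is the first \<open>u n x\<close> related to \<open>x\<close> by \<open>R\<close>.\<close>
  define R where "R = E \<inter> (space M \<times> T)"
  have R_sets: "R \<in> sets (M \<Otimes>\<^sub>M M)" unfolding R_def using E_sets T(1) by simp
  have R_count: "countable (R `` {x})" if "x \<in> space M" for x
    using count[OF that] by (rule countable_subset[rotated]) (auto simp: R_def)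
  obtain u :: "nat \<Rightarrow> 'a \<Rightarrow> 'a" where u: "\<And>n. u n \<in> M \<rightarrow>\<^sub>M M" "\<And>x y. (x, y) \<in> R \<Longrightarrow> \<exists>n. y = u n x"
    using standard_borel_lusin_novikov[OF M R_sets R_count] by blast
  obtain h :: "nat \<Rightarrow> 'a \<Rightarrow> 'a" where h: "\<And>n. h n \<in> M \<rightarrow>\<^sub>M M" "\<And>x y. (x, y) \<in> E \<Longrightarrow> \<exists>n. y = h n x"
    using standard_borel_lusin_novikov[OF M E_sets count] by blast
  define root where "root x = u (LEAST n. (x, u n x) \<in> R) x" for x
  have u_R: "{x \<in> space M. (x, u n x) \<in> R} \<in> sets M" for n
    using measurable_sets[OF measurable_Pair[OF measurable_ident u(1)] R_sets, of n]
    by (simp add: vimage_def Int_def conj_commute)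
  have "(\<lambda>x. LEAST n. (x, u n x) \<in> R) \<in> M \<rightarrow>\<^sub>M count_space UNIV"
    using u_R by (intro measurable_Least) (simp add: pred_def)
  from measurable_compose_countable[OF u(1) this]
  have root_meas: "root \<in> M \<rightarrow>\<^sub>M M" unfolding root_def .
  have root_R: "(x, root x) \<in> R" if x: "x \<in> space M" for x
  proof -
    obtain t where "t \<in> T" "(x, t) \<in> E" using T_ex1[OF x] by blast
    then have "(x, t) \<in> R" unfolding R_def using x by blast
    then have "\<exists>n. (x, u n x) \<in> R" using u(2) by metis
    then show ?thesis unfolding root_def by (rule LeastI_ex)
  qed
  have root_E: "(x, root x) \<in> E" and root_T: "root x \<in> T" if "x \<in> space M" for x
    using root_R[OF that] unfolding R_def by blast+
  have root_eq: "root x = root y" if xy: "(x, y) \<in> E" for x y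
  proof -
    have "root y \<in> T \<inter> E `` {x}" "root x \<in> T \<inter> E `` {x}"
      using root_E root_T E_sp[OF xy] E_trans[OF xy] by blast+
    then show ?thesis using T_ex1[OF E_sp(1)[OF xy]] by blast
  qed
  define g where "g n x = h n (root x)" for n x
  show thesis
  proof (rule that[of g])
    show "g n \<in> M \<rightarrow>\<^sub>M M" for n
      unfolding g_def by (rule measurable_compose[OF root_meas h(1)])
    show "\<exists>n. g n x = x" if "x \<in> space M" for x
      using h(2)[OF E_sym[OF root_E[OF that]]] unfolding g_def by metis
    show "g n x = g n y" if "(x, y) \<in> E" for n x y
      unfolding g_def root_eq[OF that] by (rule refl)
  qed
qed

section \<open>Dilworth's theorem for finite posets\<close>

lemma finite_partial_order_minimal:
  assumes "partial_order_on V r" "finite S" "S \<noteq> {}" "S \<subseteq> V"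
  obtains m where "m \<in> S" "\<And>s. s \<in> S \<Longrightarrow> (s, m) \<in> r \<Longrightarrow> s = m"
proof -
  have r: "refl_on V r" "trans r" "antisym r"
    using assms(1) by (auto simp: partial_order_on_def preorder_on_def)
  define below where "below m = {t \<in> S. (t, m) \<in> r}" for m
  obtain m where m: "m \<in> S" "\<And>s. s \<in> S \<Longrightarrow> card (below m) \<le> card (below s)"
    using ex_has_least_nat[of "\<lambda>m. m \<in> S" _ "\<lambda>m. card (below m)"] assms(3) by blast
  have "s = m" if s: "s \<in> S" "(s, m) \<in> r" for s
  proof (rule ccontr)
    assume "s \<noteq> m"
    then have "(m, s) \<notin> r" using s r(3) unfolding antisym_def by blast
    then have "m \<in> below m" "m \<notin> below s"
      using m(1) assms(4) r(1) unfolding below_def refl_on_def by blast+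
    moreover have "below s \<subseteq> below m" using s(2) r(2) unfolding below_def trans_def by blast
    ultimately have "below s \<subset> below m" by blast
    moreover have "finite (below m)" using assms(2) unfolding below_def by simp
    ultimately have "card (below s) < card (below m)" by (rule psubset_card_mono[rotated])
    with m(2)[OF s(1)] show False by simp
  qed
  with m(1) that show thesis by blast
qed

text \<open>
  Perles' proof of Dilworth's theorem.  If some antichain of size \<open>k\<close> contains neither all minimal
  nor all maximal elements, then the parts above and below it are smaller and their colourings can be
  glued along it.  Otherwise, removing a minimal element and a maximal element above it lowers the
  width.
\<close>

lemma dilworth_finite:
  assumes r: "partial_order_on V r" and "finite S" "S \<subseteq> V"
    and "\<And>A. antichain S r A \<Longrightarrow> card A \<le> k"
  shows "\<exists>f. (\<forall>x\<in>S. f x < k) \<and> (\<forall>x\<in>S. \<forall>y\<in>S. f x = f y \<longrightarrow> (x, y) \<in> r \<or> (y, x) \<in> r)"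
  using assms(2-)
proof (induction S arbitrary: k rule: finite_psubset_induct)
  case (psubset S)
  have refl: "(x, x) \<in> r" if "x \<in> S" for x
    using r psubset.prems(1) that by (auto simp: partial_order_on_def preorder_on_def refl_on_def)
  have trans: "(x, z) \<in> r" if "(x, y) \<in> r" "(y, z) \<in> r" for x y z
    using r that unfolding partial_order_on_def preorder_on_def trans_def by blast
  have antisym: "x = y" if "(x, y) \<in> r" "(y, x) \<in> r" for x y
    using r that unfolding partial_order_on_def antisym_def by blast
  have sub: "antichain S r A" if "antichain T r A" "T \<subseteq> S" for A T
    using that unfolding antichain_def by blast
  show ?case
  proof (cases "S = {}")
    case True then show ?thesis by simp
  next
    case False
    define up where "up A = {x \<in> S. \<exists>a\<in>A. (a, x) \<in> r}" for A
    define down where "down A = {x \<in> S. \<exists>a\<in>A. (x, a) \<in> r}" for A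
    show ?thesis
    proof (cases "\<exists>A. antichain S r A \<and> card A = k \<and> up A \<noteq> S \<and> down A \<noteq> S")
      case True
      then obtain A where A: "antichain S r A" "card A = k" "up A \<noteq> S" "down A \<noteq> S" by blast
      have AS: "A \<subseteq> S" and A_eq: "\<And>a b. a \<in> A \<Longrightarrow> b \<in> A \<Longrightarrow> (a, b) \<in> r \<Longrightarrow> a = b"
        using A(1) unfolding antichain_def pairwise_def by blast+
      have finA: "finite A" using AS psubset.hyps by (rule finite_subset)
      have cover: "x \<in> up A \<or> x \<in> down A" if "x \<in> S" for x
      proof (rule ccontr)
        assume out: "\<not> ?thesis"
        then have "x \<notin> A" using refl[OF that] that unfolding up_def by blast
        have "antichain S r (insert x A)"
          using A(1) that out unfolding antichain_def pairwise_insert up_def down_def by blast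
        then have "card (insert x A) \<le> k" by (rule psubset.prems)
        then show False using A(2) finA \<open>x \<notin> A\<close> by simp
      qed
      have "up A \<subset> S" "down A \<subset> S" using A(3,4) unfolding up_def down_def by blast+
      note IH = psubset.IH[OF this(1)] psubset.IH[OF this(2)]
      have "up A \<subseteq> S" "down A \<subseteq> S" unfolding up_def down_def by blast+
      note subV = this[THEN subset_trans[OF _ psubset.prems(1)]] and sub' = sub[OF _ this(1)] sub[OF _ this(2)]
      obtain f where f: "\<And>x. x \<in> up A \<Longrightarrow> f x < k"
        "\<And>x y. x \<in> up A \<Longrightarrow> y \<in> up A \<Longrightarrow> f x = f y \<Longrightarrow> (x, y) \<in> r \<or> (y, x) \<in> r"
        using IH(1)[OF subV(1) psubset.prems(2)[OF sub'(1)]] by blast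
      obtain g where g: "\<And>x. x \<in> down A \<Longrightarrow> g x < k"
        "\<And>x y. x \<in> down A \<Longrightarrow> y \<in> down A \<Longrightarrow> g x = g y \<Longrightarrow> (x, y) \<in> r \<or> (y, x) \<in> r"
        using IH(2)[OF subV(2) psubset.prems(2)[OF sub'(2)]] by blast
      have A_up: "a \<in> up A" and A_down: "a \<in> down A" if "a \<in> A" for a
        using that AS refl unfolding up_def down_def by blast+
      have f_inj: "inj_on f A" and g_inj: "inj_on g A"
        using f(2) g(2) A_up A_down A_eq unfolding inj_on_def by metis+
      have "f ` A \<subseteq> {..<k}" "g ` A \<subseteq> {..<k}" using f(1) g(1) A_up A_down by blast+
      \<comment> \<open>The \<open>k\<close> elements of \<open>A\<close> receive distinct colours
        below \<open>k\<close>, so each colour class of either part contains exactly one element of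
        \<open>A\<close>.\<close>
      then have onto: "f ` A = {..<k}" "g ` A = {..<k}"
        using card_image[OF f_inj] card_image[OF g_inj] A(2) by (simp_all add: card_subset_eq)
      have "\<exists>a\<in>A. g a = g x" if "x \<in> down A" for x
        using onto(2) g(1)[OF that] by (metis imageE lessThan_iff)
      then obtain \<tau> where \<tau>: "\<And>x. x \<in> down A \<Longrightarrow> \<tau> x \<in> A" "\<And>x. x \<in> down A \<Longrightarrow> g (\<tau> x) = g x" by metis
      have "\<exists>a\<in>A. f a = f x" if "x \<in> up A" for x
        using onto(1) f(1)[OF that] by (metis imageE lessThan_iff)
      then obtain \<sigma> where \<sigma>: "\<And>x. x \<in> up A \<Longrightarrow> \<sigma> x \<in> A" "\<And>x. x \<in> up A \<Longrightarrow> f (\<sigma> x) = f x" by metis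
      \<comment> \<open>Were \<open>\<tau> x\<close> below \<open>x\<close> instead, it would lie
        below some \<open>a\<close> in \<open>A\<close> above \<open>x\<close>, and the antichain
        would force \<open>\<tau> x = a\<close>.\<close>
      have \<tau>_le: "(x, \<tau> x) \<in> r" if x: "x \<in> down A" for x
      proof (rule ccontr)
        assume n: "(x, \<tau> x) \<notin> r"
        then have "(\<tau> x, x) \<in> r" using g(2)[OF x A_down[OF \<tau>(1)[OF x]]] \<tau>(2)[OF x] by simp
        moreover obtain a where a: "a \<in> A" "(x, a) \<in> r" using x unfolding down_def by blast
        ultimately have "\<tau> x = a" using A_eq[OF \<tau>(1)[OF x] a(1)] trans by blast
        with a n show False by simp
      qed
      have \<sigma>_le: "(\<sigma> x, x) \<in> r" if x: "x \<in> up A" for x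
      proof (rule ccontr)
        assume n: "(\<sigma> x, x) \<notin> r"
        then have "(x, \<sigma> x) \<in> r" using f(2)[OF x A_up[OF \<sigma>(1)[OF x]]] \<sigma>(2)[OF x] by simp
        moreover obtain a where a: "a \<in> A" "(a, x) \<in> r" using x unfolding up_def by blast
        ultimately have "a = \<sigma> x" using A_eq[OF a(1) \<sigma>(1)[OF x]] trans by blast
        with a n show False by simp
      qed
      \<comment> \<open>The colours of the lower part are renamed so that each class is joined to
        the upper class through the same element of \<open>A\<close>.\<close>
      define h where "h x = (if x \<in> up A then f x else f (\<tau> x))" for x
      have mixed: "(x, y) \<in> r" if "x \<in> down A" "y \<in> up A" "f (\<tau> x) = f y" for x y
      proof -
        have "\<tau> x = \<sigma> y" using inj_onD[OF f_inj _ \<tau>(1)[OF that(1)] \<sigma>(1)[OF that(2)]] \<sigma>(2)[OF that(2)] that(3) by simp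
        then show ?thesis using trans[OF \<tau>_le[OF that(1)]] \<sigma>_le[OF that(2)] by simp
      qed
      have lower: "(x, y) \<in> r \<or> (y, x) \<in> r" if "x \<in> down A" "y \<in> down A" "f (\<tau> x) = f (\<tau> y)" for x y
      proof -
        have "\<tau> x = \<tau> y" using inj_onD[OF f_inj that(3) \<tau>(1)[OF that(1)] \<tau>(1)[OF that(2)]] .
        then have "g x = g y" using \<tau>(2) that by metis
        then show ?thesis using g(2) that by blast
      qed
      have "h x < k" if "x \<in> S" for x
        using f(1) A_up \<tau>(1) cover[OF that] unfolding h_def by (cases "x \<in> up A") auto
      moreover have "(x, y) \<in> r \<or> (y, x) \<in> r" if "x \<in> S" "y \<in> S" "h x = h y" for x y
        using that(3) cover[OF that(1)] cover[OF that(2)] f(2)[of x y] mixed[of x y] mixed[of y x] lower[of x y]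
        unfolding h_def by (auto split: if_splits)
      ultimately show ?thesis by blast
    next
      case no_cut: False
      obtain x where x: "x \<in> S" "\<And>s. s \<in> S \<Longrightarrow> (s, x) \<in> r \<Longrightarrow> s = x"
        using finite_partial_order_minimal[OF r psubset.hyps False psubset.prems(1)] by blast
      define T where "T = {s \<in> S. (x, s) \<in> r}"
      have T: "finite T" "T \<noteq> {}" "T \<subseteq> V"
        using psubset.hyps refl[OF x(1)] x(1) psubset.prems(1) unfolding T_def by auto
      have "partial_order_on V (r\<inverse>)" using r by simp
      then obtain y where y: "y \<in> T" "\<And>s. s \<in> T \<Longrightarrow> (s, y) \<in> r\<inverse> \<Longrightarrow> s = y"
        using finite_partial_order_minimal[OF _ T] by blast
      have xy: "y \<in> S" "(x, y) \<in> r" using y(1) unfolding T_def by blast+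
      have y_max: "s = y" if "s \<in> S" "(y, s) \<in> r" for s
        using y(2)[of s] that trans[OF xy(2) that(2)] unfolding T_def by blast
      have "antichain S r {x}" using x(1) unfolding antichain_def by simp
      from psubset.prems(2)[OF this] have "k \<ge> 1" by simp
      \<comment> \<open>\<open>k\<close> is only an upper bound for the width, so the claim is
        immediate when no antichain has size \<open>k\<close>. Otherwise an antichain of size
        \<open>k\<close> has \<open>up A = S\<close> or \<open>down A = S\<close>, and then
        minimality of \<open>x\<close> or maximality of \<open>y\<close> puts \<open>x\<close> or
        \<open>y\<close> into \<open>A\<close>.\<close>
      have small: "card A \<le> k - 1" if "antichain (S - {x, y}) r A" for A
      proof (rule ccontr)
        assume "\<not> ?thesis"
        moreover have anti: "antichain S r A" using that sub by blast
        ultimately have "card A = k" using psubset.prems(2)[OF anti] by simp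
        then consider "up A = S" | "down A = S" using no_cut anti by blast
        then show False
        proof cases
          case 1
          then obtain a where "a \<in> A" "(a, x) \<in> r" using x(1) unfolding up_def by blast
          then show False using x(2)[of a] that unfolding antichain_def by blast
        next
          case 2
          then obtain a where "a \<in> A" "(y, a) \<in> r" using xy(1) unfolding down_def by blast
          then show False using y_max[of a] that unfolding antichain_def by blast
        qed
      qed
      have rest: "S - {x, y} \<subset> S" "S - {x, y} \<subseteq> V" using x(1) psubset.prems(1) by blast+
      obtain f where f: "\<And>z. z \<in> S - {x, y} \<Longrightarrow> f z < k - 1"
        "\<And>z w. z \<in> S - {x, y} \<Longrightarrow> w \<in> S - {x, y} \<Longrightarrow> f z = f w \<Longrightarrow> (z, w) \<in> r \<or> (w, z) \<in> r"
        using psubset.IH[OF rest small] by blast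
      define h where "h z = (if z \<in> {x, y} then k - 1 else f z)" for z
      have "h z < k" if "z \<in> S" for z
        using f(1)[of z] that \<open>k \<ge> 1\<close> unfolding h_def by (cases "z \<in> {x, y}") auto
      moreover have "(z, w) \<in> r \<or> (w, z) \<in> r" if "z \<in> S" "w \<in> S" "h z = h w" for z w
      proof (cases "z \<in> {x, y}")
        case True
        then have "w \<in> {x, y}" using that f(1)[of w] unfolding h_def by (cases "w \<in> {x, y}") auto
        then show ?thesis using True xy refl x(1) by blast
      next
        case False
        then have "w \<notin> {x, y}" using that f(1)[of z] unfolding h_def by (cases "w \<in> {x, y}") auto
        then show ?thesis using False f(2)[of z w] that unfolding h_def by simp
      qed
      ultimately show ?thesis by blast
    qed
  qed
qed

section \<open>Lexicographically least colourings\<close>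

definition proper_colouring :: "nat \<Rightarrow> (nat \<Rightarrow> nat \<Rightarrow> bool) \<Rightarrow> nat list \<Rightarrow> bool" where
  "proper_colouring k G xs \<longleftrightarrow>
     (\<forall>i<length xs. xs ! i < k) \<and> (\<forall>i<length xs. \<forall>j<length xs. G i j \<longrightarrow> xs ! i \<noteq> xs ! j)"

text \<open>
  By Koenig's lemma this means that \<open>xs\<close> extends to a colouring of all vertices; the formulation by
  finite extensions makes it a measurable condition on \<open>G\<close>.
\<close>

definition extendible :: "nat \<Rightarrow> (nat \<Rightarrow> nat \<Rightarrow> bool) \<Rightarrow> nat list \<Rightarrow> bool" where
  "extendible k G xs \<longleftrightarrow> (\<forall>n. \<exists>ys. length ys = n \<and> proper_colouring k G (xs @ ys))"

primrec least_colouring :: "nat \<Rightarrow> (nat \<Rightarrow> nat \<Rightarrow> bool) \<Rightarrow> nat \<Rightarrow> nat list" where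
  "least_colouring k G 0 = []"
| "least_colouring k G (Suc n) =
     least_colouring k G n @ [LEAST c. extendible k G (least_colouring k G n @ [c])]"

lemma proper_colouring_prefix:
  assumes "proper_colouring k G (xs @ ys)" shows "proper_colouring k G xs"
  unfolding proper_colouring_def
proof (intro conjI allI impI)
  have n: "(xs @ ys) ! i = xs ! i" "i < length (xs @ ys)" if "i < length xs" for i
    using that by (simp_all add: nth_append)
  show "xs ! i < k" if "i < length xs" for i
    using assms n[OF that] unfolding proper_colouring_def by metis
  show "xs ! i \<noteq> xs ! j" if "i < length xs" "j < length xs" "G i j" for i j
    using assms n[OF that(1)] n[OF that(2)] that(3) unfolding proper_colouring_def by metis
qed

text \<open>Pigeonhole on the finitely many colours: if every colour \<open>c\<close> failed at some
  length \<open>b c\<close>, a sufficiently long extension, truncated to the length at which its own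
  first colour fails, would be a contradiction.\<close>

lemma extendible_step:
  assumes "extendible k G xs" shows "\<exists>c. extendible k G (xs @ [c])"
proof (rule ccontr)
  assume "\<not> ?thesis"
  then have "\<forall>c. \<exists>n. \<forall>ys. length ys = n \<longrightarrow> \<not> proper_colouring k G ((xs @ [c]) @ ys)"
    unfolding extendible_def by blast
  then obtain b where b: "\<And>c ys. length ys = b c \<Longrightarrow> \<not> proper_colouring k G ((xs @ [c]) @ ys)" by metis
  define N where "N = (\<Sum>c<k. b c)"
  obtain zs where zs: "length zs = Suc N" "proper_colouring k G (xs @ zs)"
    using assms unfolding extendible_def by blast
  then obtain c ys where cy: "zs = c # ys" "length ys = N" by (cases zs) auto
  have "(xs @ zs) ! length xs < k" using zs unfolding proper_colouring_def by simp
  then have "c < k" unfolding cy(1) by simp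
  then have "b c \<le> N" unfolding N_def by (intro member_le_sum) auto
  then have "length (take (b c) ys) = b c" using cy(2) by simp
  moreover have "proper_colouring k G ((xs @ [c]) @ take (b c) ys)"
  proof (rule proper_colouring_prefix)
    show "proper_colouring k G (((xs @ [c]) @ take (b c) ys) @ drop (b c) ys)"
      using zs(2) unfolding cy(1) by simp
  qed
  ultimately show False using b by blast
qed

lemma length_least_colouring [simp]: "length (least_colouring k G n) = n"
  by (induction n) auto

text \<open>Later stages only append, so the finite lists are initial segments of a single infinite
  colouring.\<close>

lemma nth_least_colouring:
  assumes "i < n" shows "least_colouring k G n ! i = least_colouring k G (Suc i) ! i"
  using assms by (induction n) (auto simp: nth_append less_Suc_eq)

lemma least_colouring_proper:
  assumes "\<And>n. \<exists>ys. length ys = n \<and> proper_colouring k G ys"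
  shows "proper_colouring k G (least_colouring k G n)"
proof -
  have "extendible k G (least_colouring k G n)"
  proof (induction n)
    case 0 then show ?case using assms unfolding extendible_def by simp
  next
    case (Suc n)
    from LeastI_ex[OF extendible_step[OF this]] show ?case by simp
  qed
  then show ?thesis unfolding extendible_def by (metis append_Nil2 length_0_conv)
qed

text \<open>Each stage takes values in the countable type of lists, so the recursion step can be
  checked for a fixed previous list. There it is a least-number search over conditions built
  countably from the sets where \<open>G x i j\<close> holds.\<close>

lemma measurable_least_colouring:
  assumes G: "\<And>i j. {x \<in> space M. G x i j} \<in> sets M"
  shows "(\<lambda>x. least_colouring k (G x) n) \<in> M \<rightarrow>\<^sub>M count_space UNIV"
proof (induction n)
  case (Suc n)
  have [measurable]: "Measurable.pred M (\<lambda>x. G x i j)" for i j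
    using G by (simp add: pred_def)
  have [measurable]: "Measurable.pred M (\<lambda>x. proper_colouring k (G x) ys)" for ys
    unfolding proper_colouring_def by measurable
  have "Measurable.pred M (\<lambda>x. extendible k (G x) ys)" for ys
    unfolding extendible_def by measurable
  then have "(\<lambda>x. xs @ [LEAST c. extendible k (G x) (xs @ [c])]) \<in> M \<rightarrow>\<^sub>M count_space UNIV" for xs
    by measurable
  from measurable_compose_countable[OF this Suc] show ?case by simp
qed simp

section \<open>Borel chain decompositions\<close>

theorem theorem8:
  fixes M :: "'a measure" and r :: "'a rel" and k :: nat
  assumes "borel_poset M r"
    and "has_width (space M) r k"
    and "locally_countable (space M) (incomp_graph (space M) r)"
    and "smooth_equiv M (connected_rel (space M) (incomp_graph (space M) r))"
  shows "\<exists>C :: nat \<Rightarrow> 'a set.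
           (\<forall>i<k. C i \<in> sets M \<and> C i \<in> Chains r) \<and>
           disjoint_family_on C {..<k} \<and> (\<Union>i<k. C i) = space M"
proof -
  let ?G = "incomp_graph (space M) r"
  let ?E = "connected_rel (space M) ?G"
  have M: "standard_borel M" and r: "partial_order_on (space M) r" and r_sets: "r \<in> sets (M \<Otimes>\<^sub>M M)"
    using assms(1) unfolding borel_poset_def by blast+
  have r_refl: "(x, x) \<in> r" if "x \<in> space M" for x
    using r that by (auto simp: partial_order_on_def preorder_on_def refl_on_def)
  have G_sub: "?G \<subseteq> space M \<times> space M" unfolding incomp_graph_def by blast
  obtain g :: "nat \<Rightarrow> 'a \<Rightarrow> 'a" where g: "\<And>n. g n \<in> M \<rightarrow>\<^sub>M M" "\<And>x. x \<in> space M \<Longrightarrow> \<exists>n. g n x = x"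
    "\<And>n x y. (x, y) \<in> ?E \<Longrightarrow> g n x = g n y"
    using smooth_countable_equiv_enumeration[OF M assms(4)
          locally_countable_component[OF assms(3) G_sub]]
    by blast
  have g_sp: "g n x \<in> space M" if "x \<in> space M" for n x
    using measurable_space[OF g(1) that] .
  have rel_meas: "{x \<in> space M. (f x, f' x) \<in> r} \<in> sets M" if "f \<in> M \<rightarrow>\<^sub>M M" "f' \<in> M \<rightarrow>\<^sub>M M" for f f'
    using measurable_sets[OF measurable_Pair[OF that] r_sets] by (simp add: vimage_def Int_def conj_commute)
  \<comment> \<open>The graph is placed on indices because the enumeration is constant on
    components. A point listed several times may receive several colours, as indices of the same
    point are not adjacent; \<open>idx\<close> later selects one of them.\<close>
  define adj where "adj x i j \<longleftrightarrow> (g i x, g j x) \<in> ?G" for x i j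
  have adj_iff: "adj x i j \<longleftrightarrow> (g i x, g j x) \<notin> r \<and> (g j x, g i x) \<notin> r" if "x \<in> space M" for x i j
    using g_sp[OF that] r_refl[of "g i x"] unfolding adj_def incomp_graph_def by auto
  have "{x \<in> space M. adj x i j} \<in> sets M" for i j
  proof -
    have "{x \<in> space M. \<not> (g i x, g j x) \<in> r \<and> \<not> (g j x, g i x) \<in> r} \<in> sets M"
      by (intro sets.sets_Collect_conj sets.sets_Collect_neg rel_meas g(1))
    then show ?thesis using adj_iff by (simp cong: conj_cong)
  qed
  note least_meas = measurable_least_colouring[OF this, of k]
  have colourable: "\<exists>ys. length ys = n \<and> proper_colouring k (adj x) ys" if x: "x \<in> space M" for x n
  proof -
    let ?S = "(\<lambda>i. g i x) ` {..<n}"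
    have S_sub: "?S \<subseteq> space M" using g_sp[OF x] by blast
    have S_anti: "card A \<le> k" if "antichain ?S r A" for A
    proof -
      have "antichain (space M) r A" using that S_sub unfolding antichain_def by blast
      then show ?thesis using assms(2) unfolding has_width_def by blast
    qed
    have "finite ?S" by simp
    then have "\<exists>f. (\<forall>x\<in>?S. f x < k) \<and> (\<forall>x\<in>?S. \<forall>y\<in>?S. f x = f y \<longrightarrow> (x, y) \<in> r \<or> (y, x) \<in> r)"
      by (rule dilworth_finite[OF r _ S_sub]) (rule S_anti)
    then obtain f where f: "\<forall>x\<in>?S. f x < k" "\<forall>x\<in>?S. \<forall>y\<in>?S. f x = f y \<longrightarrow> (x, y) \<in> r \<or> (y, x) \<in> r"
      by (elim exE conjE)
    show ?thesis
    proof (intro exI conjI)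
      show "length (map (\<lambda>i. f (g i x)) [0..<n]) = n" by simp
      show "proper_colouring k (adj x) (map (\<lambda>i. f (g i x)) [0..<n])"
        unfolding proper_colouring_def
      proof (intro conjI allI impI)
        fix i assume "i < length (map (\<lambda>i. f (g i x)) [0..<n])"
        then have i: "i < n" by simp
        then show "map (\<lambda>i. f (g i x)) [0..<n] ! i < k" using f(1) by simp
        fix j assume "j < length (map (\<lambda>i. f (g i x)) [0..<n])" and adj: "adj x i j"
        then have j: "j < n" by simp
        have "f (g i x) \<noteq> f (g j x)" using f(2) i j adj adj_iff[OF x] by blast
        then show "map (\<lambda>i. f (g i x)) [0..<n] ! i \<noteq> map (\<lambda>i. f (g i x)) [0..<n] ! j"
          using i j by simp
      qed
    qed
  qed
  define col where "col x i = least_colouring k (adj x) (Suc i) ! i" for x i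
  have col_meas: "(\<lambda>x. col x i) \<in> M \<rightarrow>\<^sub>M count_space UNIV" for i
    unfolding col_def by (rule measurable_compose[OF least_meas]) simp
  have col_less: "col x i < k" if "x \<in> space M" for x i
    using least_colouring_proper[OF colourable[OF that], of "Suc i"]
    unfolding proper_colouring_def col_def by simp
  have col_adj: "col x i \<noteq> col x j" if "x \<in> space M" "adj x i j" for x i j
  proof -
    define n where "n = Suc (max i j)"
    have ij: "i < n" "j < n" unfolding n_def by simp_all
    have "least_colouring k (adj x) n ! i \<noteq> least_colouring k (adj x) n ! j"
      using least_colouring_proper[OF colourable[OF that(1)], of n] that(2) ij
      unfolding proper_colouring_def by simp
    then show ?thesis unfolding col_def nth_least_colouring[OF ij(1)] nth_least_colouring[OF ij(2)] .
  qed
  \<comment> \<open>Stating \<open>g i x = x\<close> through \<open>r\<close> avoids a separate proof that the diagonal is measurable.\<close>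
  define idx where "idx x = (LEAST i. (g i x, x) \<in> r \<and> (x, g i x) \<in> r)" for x
  have idx: "g (idx x) x = x" if "x \<in> space M" for x
  proof -
    have "\<exists>i. (g i x, x) \<in> r \<and> (x, g i x) \<in> r" using g(2)[OF that] r_refl[OF that] by metis
    from LeastI_ex[OF this] have "(g (idx x) x, x) \<in> r" "(x, g (idx x) x) \<in> r" unfolding idx_def by blast+
    then show ?thesis using r unfolding partial_order_on_def antisym_def by blast
  qed
  have "{x \<in> space M. (g i x, x) \<in> r \<and> (x, g i x) \<in> r} \<in> sets M" for i
    using rel_meas[OF g(1) measurable_ident] rel_meas[OF measurable_ident g(1)]
    by (intro sets.sets_Collect_conj) simp_all
  then have "idx \<in> M \<rightarrow>\<^sub>M count_space UNIV"
    unfolding idx_def by (intro measurable_Least) (simp add: pred_def)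
  from measurable_compose_countable[OF col_meas this]
  have colour_meas: "(\<lambda>x. col x (idx x)) \<in> M \<rightarrow>\<^sub>M count_space UNIV" .
  define C where "C i = {x \<in> space M. col x (idx x) = i}" for i
  have "C i \<in> sets M" for i
    using measurable_sets[OF colour_meas, of "{i}"] unfolding C_def
    by (simp add: vimage_def Int_def conj_commute)
  moreover have "C i \<in> Chains r" for i
  proof -
    have "(x, y) \<in> r \<or> (y, x) \<in> r" if "x \<in> C i" "y \<in> C i" for x y
    proof (rule ccontr)
      \<comment> \<open>Incomparable points are adjacent, hence in one component, so they share the
        enumeration and the colouring of indices. Their selected indices are then adjacent and
        coloured differently. Points of different components never arise here, being
        comparable.\<close>
      assume incomp: "\<not> ?thesis"
      have x: "x \<in> space M" and y: "y \<in> space M" and eq: "col x (idx x) = col y (idx y)"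
        using that unfolding C_def by auto
      have xy: "(x, y) \<in> ?G" using incomp x y r_refl[OF x] unfolding incomp_graph_def by auto
      then have "(x, y) \<in> ?E" unfolding connected_rel_def using x y by blast
      then have gxy: "g n x = g n y" for n by (rule g(3))
      then have "adj x = adj y" unfolding adj_def by simp
      then have "col y = col x" unfolding col_def by simp
      moreover have "adj x (idx x) (idx y)"
        unfolding adj_def idx[OF x] gxy[of "idx y"] idx[OF y] by (rule xy)
      ultimately show False using col_adj[OF x] eq by metis
    qed
    then show ?thesis unfolding Chains_def by blast
  qed
  moreover have "disjoint_family_on C {..<k}" unfolding disjoint_family_on_def C_def by auto
  moreover have "(\<Union>i<k. C i) = space M" using col_less unfolding C_def by auto
  ultimately show ?thesis by blast
qed

end
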